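(* For all $L\in\{2,3,\ldots\}$, $d\in\mathbb{N}$ and $a>1$ there exist $q\in(0,1)$ and $N_0,N_1\in\mathbb{N}$ such that site-bond percolation on $\mathbb{H}^d_L$ with the kernel \[J(e)=\begin{cases}\dfrac{aL^d\log\log(|e|)}{|e|^{2d}}&\text{if }|e|\ge N_1,\\ N_0&\text{if }|e|<N_1\end{cases}\] satisfies $\mathbb{P}_{q,J}(|K_0|=\infty)>0$.
   Context: The hierarchical lattice $\mathbb{H}^d_L$ is the group $\bigoplus_{i=1}^\infty(\mathbb{Z}/L\mathbb{Z})^d$ with ultrametric $\|x-y\|=L^{\max\{i:x_i\neq y_i\}}$ for $x\neq y$; edges are unordered pairs $e=\{x,y\}$ of distinct vertices with $|e|=\|x-y\|$. For $q\in[0,1]$ and a kernel $J:E\to[0,\infty)$, $\mathbb{P}_{q,J}$ is the law of the random graph in which each vertex is open independently with probability $q$ and, independently, each edge between two open vertices is open independently with probability $1-\exp(-J(e))$. $K_0$ denotes the open cluster of the origin. *)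

theory Defs
  imports "HOL-Probability.Probability"
begin

text \<open>Vertices of the hierarchical lattice H^d_L: a vertex x is a function with
  x i j the j-th coordinate (in Z/LZ, represented by 0..L-1) of the i-th block
  (blocks indexed from 0, i.e. block i of the paper is block i-1 here),
  finitely many nonzero blocks.\<close>

type_synonym hvert = "nat \<Rightarrow> nat \<Rightarrow> nat"

definition hverts :: "nat \<Rightarrow> nat \<Rightarrow> hvert set" where
  "hverts L d = {x. (\<forall>i j. x i j < L) \<and> (\<forall>i j. d \<le> j \<longrightarrow> x i j = 0)
                   \<and> finite {i. x i \<noteq> (\<lambda>_. 0)}}"

definition horigin :: hvert where
  "horigin = (\<lambda>i j. 0)"

definition hedges :: "nat \<Rightarrow> nat \<Rightarrow> hvert set set" where
  "hedges L d = {{x, y} | x y. x \<in> hverts L d \<and> y \<in> hverts L d \<and> x \<noteq> y}"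

text \<open>Length |e| = ||x - y|| = L^(max block index where x,y differ), with
  1-based block indexing of the paper.\<close>
definition hlen :: "nat \<Rightarrow> hvert set \<Rightarrow> real" where
  "hlen L e = real L ^ Suc (Max {i. \<exists>x\<in>e. \<exists>y\<in>e. x i \<noteq> y i})"

definition hindex :: "nat \<Rightarrow> nat \<Rightarrow> (hvert + hvert set) set" where
  "hindex L d = Inl ` hverts L d \<union> Inr ` hedges L d"

definition perc_measure ::
  "nat \<Rightarrow> nat \<Rightarrow> real \<Rightarrow> (hvert set \<Rightarrow> real) \<Rightarrow> ((hvert + hvert set) \<Rightarrow> bool) measure" where
  "perc_measure L d q J = PiM (hindex L d)
     (\<lambda>i. case i of Inl v \<Rightarrow> measure_pmf (bernoulli_pmf q)
                  | Inr e \<Rightarrow> measure_pmf (bernoulli_pmf (1 - exp (- J e))))"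

definition open_edge_rel ::
  "nat \<Rightarrow> nat \<Rightarrow> ((hvert + hvert set) \<Rightarrow> bool) \<Rightarrow> (hvert \<times> hvert) set" where
  "open_edge_rel L d \<omega> = {(x, y). {x, y} \<in> hedges L d \<and> \<omega> (Inl x) \<and> \<omega> (Inl y) \<and> \<omega> (Inr {x, y})}"

text \<open>Open cluster K_0 of the origin (empty if the origin is closed).\<close>
definition cluster0 :: "nat \<Rightarrow> nat \<Rightarrow> ((hvert + hvert set) \<Rightarrow> bool) \<Rightarrow> hvert set" where
  "cluster0 L d \<omega> = {y. \<omega> (Inl horigin) \<and> (horigin, y) \<in> (open_edge_rel L d \<omega>)\<^sup>*}"

definition kernelJ :: "nat \<Rightarrow> nat \<Rightarrow> real \<Rightarrow> nat \<Rightarrow> nat \<Rightarrow> hvert set \<Rightarrow> real" where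
  "kernelJ L d a N0 N1 e =
     (if hlen L e \<ge> real N1
      then a * real L ^ d * ln (ln (hlen L e)) / hlen L e ^ (2 * d)
      else real N0)"

end

theory Submission
  imports Defs "HOL-Real_Asymp.Real_Asymp"
begin

text \<open>
Put \<open>b = L^d\<close>, so that an \<open>n\<close>-block (a ball of radius \<open>L^n\<close>) has \<open>b^n\<close> vertices. Merging an
\<open>n\<close>-block with its siblings fails with the non-summable probability \<open>n^(-a (1 - 1/b))\<close>, but a
block stays isolated throughout the next \<open>k\<close> levels only with probability about
\<open>n^(-a (1 - b^-k))\<close>, which is summable for large \<open>k\<close> because \<open>a > 1\<close>. Accordingly a vertex is
kept at level \<open>n\<close> as long as its cluster inside its \<open>n\<close>-block has at least \<open>b^(n-k)\<close> vertices.
A vertex dropped at level \<open>n + 1\<close> lies in a cluster of an \<open>(n+1)\<close>-block of size between \<open>b^(n-k)\<close>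
and \<open>b^(n+1-k)\<close> with no open edges to the rest of that block. Conditioning on the inside of the
\<open>(n-H)\<close>-blocks leaves boundedly many candidates for such a cluster, and an isoperimetric estimate
shows that the edges leaving any of them have total weight at least \<open>(1 - \<epsilon>) a ln n\<close>, provided
that nearly all vertices were kept at level \<open>n - H\<close>. That proviso fails only if two disjoint
blocks are bad; the probability of one bad block is controlled by Chebyshev's inequality over
about \<open>b^(sqrt n)\<close> independent subblocks together with the losses at the levels between, so by
induction it is \<open>O(n^(-1/2-\<eta>))\<close>, and its square is summable. The induction starts from blocks
that are completely open with probability close to one, by the choice of \<open>q\<close> and \<open>N0\<close>.
\<close>

section \<open>Blocks of the hierarchical lattice\<close>

locale hierarchical =
  fixes L d :: nat
  assumes L_ge_2: "2 \<le> L" and d_ge_1: "1 \<le> d"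
begin

abbreviation V :: "hvert set" where "V \<equiv> hverts L d"
abbreviation b :: nat where "b \<equiv> L ^ d"

definition blk :: "nat \<Rightarrow> hvert \<Rightarrow> hvert set" where
  "blk n x = {y \<in> V. \<forall>i\<ge>n. y i = x i}"

text \<open>Base-\<open>L\<close> logarithm of the ultrametric distance on \<open>V\<close>,
  extended by 0 to the diagonal. Blocks are indexed from 0, so agreement from index \<open>n\<close>
  on means distance at most \<open>L^n\<close>.\<close>

definition lev :: "hvert \<Rightarrow> hvert \<Rightarrow> nat" where
  "lev x y = (LEAST n. y \<in> blk n x)"

lemma b_ge_2: "2 \<le> b"
  using L_ge_2 d_ge_1 self_le_power[of L d] by linarith

lemma blk_subset: "blk n x \<subseteq> V"
  by (auto simp: blk_def)

lemma blk_refl: "x \<in> V \<Longrightarrow> x \<in> blk n x"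
  by (auto simp: blk_def)

lemma blk_eq: "y \<in> blk n x \<Longrightarrow> blk n y = blk n x"
  by (auto simp: blk_def)

lemma blk_mono: "m \<le> n \<Longrightarrow> blk m x \<subseteq> blk n x"
  by (auto simp: blk_def)

lemma blk_nested: "m \<le> n \<Longrightarrow> y \<in> blk n x \<Longrightarrow> blk m y \<subseteq> blk n x"
  using blk_mono blk_eq by blast

lemma blk_disjoint: "blk n x \<noteq> blk n y \<Longrightarrow> blk n x \<inter> blk n y = {}"
  using blk_eq by blast

lemma horigin_in_V: "horigin \<in> V"
  using L_ge_2 by (auto simp: hverts_def horigin_def)

lemma ex_blk:
  assumes "x \<in> V" "y \<in> V"
  shows "\<exists>n. y \<in> blk n x"
proof -
  have "finite ({i. x i \<noteq> (\<lambda>_. 0)} \<union> {i. y i \<noteq> (\<lambda>_. 0)})"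
    using assms by (simp add: hverts_def)
  then obtain n where "\<forall>i\<in>{i. x i \<noteq> (\<lambda>_. 0)} \<union> {i. y i \<noteq> (\<lambda>_. 0)}. i < n"
    using finite_nat_set_iff_bounded by blast
  then have "y i = x i" if "i \<ge> n" for i
    using that by (metis (mono_tags, lifting) Un_iff mem_Collect_eq not_less)
  then have "y \<in> blk n x"
    using assms by (simp add: blk_def)
  then show ?thesis ..
qed

lemma in_blk_iff: "x \<in> V \<Longrightarrow> y \<in> V \<Longrightarrow> y \<in> blk n x \<longleftrightarrow> lev x y \<le> n"
  unfolding lev_def by (metis LeastI_ex Least_le blk_mono ex_blk subsetD)

text \<open>The two exponents are identified by comparing their upper bounds: both are at most
  \<open>n\<close> exactly when every index where \<open>x\<close> and \<open>y\<close> differ is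
  below \<open>n\<close>. The \<open>Suc\<close> in \<open>hlen\<close> compensates for indexing
  from 0.\<close>

lemma hlen_eq:
  assumes "x \<in> V" "y \<in> V" "x \<noteq> y"
  shows "hlen L {x, y} = real L ^ lev x y"
proof -
  let ?D = "{i. x i \<noteq> y i}"
  have D: "{i. \<exists>u\<in>{x, y}. \<exists>v\<in>{x, y}. u i \<noteq> v i} = ?D" by auto
  have "finite ({i. x i \<noteq> (\<lambda>_. 0)} \<union> {i. y i \<noteq> (\<lambda>_. 0)})"
    using assms by (simp add: hverts_def)
  then have fin: "finite ?D" by (rule rev_finite_subset) auto
  have ne: "?D \<noteq> {}" using assms(3) by auto
  have "lev x y \<le> n \<longleftrightarrow> Suc (Max ?D) \<le> n" for n
  proof -
    have "lev x y \<le> n \<longleftrightarrow> (\<forall>i\<ge>n. y i = x i)"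
      using in_blk_iff[OF assms(1,2), of n] assms by (auto simp: blk_def)
    also have "\<dots> \<longleftrightarrow> (\<forall>i\<in>?D. i < n)" by (metis (mono_tags) mem_Collect_eq not_less)
    also have "\<dots> \<longleftrightarrow> Suc (Max ?D) \<le> n" using fin ne by (simp add: Suc_le_eq)
    finally show ?thesis .
  qed
  then have "lev x y = Suc (Max ?D)" by (meson le_antisym le_refl)
  then show ?thesis unfolding hlen_def D by simp
qed

section \<open>Counting vertices and subblocks\<close>

lemma card_coordinates:
  "finite {c::nat \<Rightarrow> nat. (\<forall>j. c j < L) \<and> (\<forall>j\<ge>d. c j = 0)} \<and>
   card {c::nat \<Rightarrow> nat. (\<forall>j. c j < L) \<and> (\<forall>j\<ge>d. c j = 0)} = b"
proof -
  let ?C = "{c::nat \<Rightarrow> nat. (\<forall>j. c j < L) \<and> (\<forall>j\<ge>d. c j = 0)}"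
  have bij: "bij_betw (\<lambda>c. restrict c {..<d}) ?C ({..<d} \<rightarrow>\<^sub>E {..<L})"
  proof (rule bij_betwI[where g="\<lambda>f j. if j < d then f j else 0"])
    show "(\<lambda>c. restrict c {..<d}) \<in> ?C \<rightarrow> ({..<d} \<rightarrow>\<^sub>E {..<L})" by simp
    show "(\<lambda>f j. if j < d then f j else 0) \<in> ({..<d} \<rightarrow>\<^sub>E {..<L}) \<rightarrow> ?C"
      using L_ge_2 by (auto simp: PiE_iff)
    show "(\<lambda>j. if j < d then restrict c {..<d} j else 0) = c" if "c \<in> ?C" for c
      using that by (auto simp: fun_eq_iff)
    show "restrict (\<lambda>j. if j < d then f j else 0) {..<d} = f" if "f \<in> {..<d} \<rightarrow>\<^sub>E {..<L}" for f
      using that by (auto simp: fun_eq_iff PiE_iff extensional_def)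
  qed
  have "finite ({..<d} \<rightarrow>\<^sub>E {..<L})" "card ({..<d} \<rightarrow>\<^sub>E {..<L}) = b"
    by (simp_all add: card_PiE finite_PiE)
  then show ?thesis
    using bij_betw_same_card[OF bij] bij_betw_finite[OF bij] by simp
qed

text \<open>An \<open>(n+1)\<close>-block splits into the \<open>b\<close> disjoint
  \<open>n\<close>-blocks around the points obtained by overwriting coordinate \<open>n\<close> of
  the centre.\<close>

lemma finite_card_blk:
  assumes "x \<in> V"
  shows "finite (blk n x) \<and> card (blk n x) = b ^ n"
  using assms
proof (induction n arbitrary: x)
  case 0
  then have "blk 0 x = {x}" by (auto simp: blk_def)
  then show ?case by simp
next
  case (Suc n)
  let ?C = "{c::nat \<Rightarrow> nat. (\<forall>j. c j < L) \<and> (\<forall>j\<ge>d. c j = 0)}"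
  have upd: "x(n := c) \<in> V" if "c \<in> ?C" for c
  proof -
    have "finite (insert n {i. x i \<noteq> (\<lambda>_. 0)})"
      using Suc.prems by (simp add: hverts_def)
    then have "finite {i. (x(n := c)) i \<noteq> (\<lambda>_. 0)}"
      by (rule rev_finite_subset) (auto split: if_splits)
    then show ?thesis
      using that Suc.prems by (auto simp: hverts_def)
  qed
  have eq: "blk (Suc n) x = (\<Union>c\<in>?C. blk n (x(n := c)))"
  proof (intro equalityI subsetI)
    fix y assume y: "y \<in> blk (Suc n) x"
    then have "y n \<in> ?C" by (auto simp: blk_def hverts_def)
    moreover have "y \<in> blk n (x(n := y n))"
      using y by (auto simp: blk_def)
    ultimately show "y \<in> (\<Union>c\<in>?C. blk n (x(n := c)))" by blast
  qed (auto simp: blk_def)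
  have disj: "blk n (x(n := c)) \<inter> blk n (x(n := c')) = {}" if "c \<noteq> c'" for c c'
    using that by (auto simp: blk_def)
  have "finite ?C" "card ?C = b" using card_coordinates by auto
  moreover have fc: "finite (blk n (x(n := c)))" "card (blk n (x(n := c))) = b ^ n" if "c \<in> ?C" for c
    using Suc.IH[OF upd[OF that]] by blast+
  ultimately have "card (\<Union>c\<in>?C. blk n (x(n := c))) = (\<Sum>c\<in>?C. b ^ n)"
    by (subst card_UN_disjoint) (use disj in auto)
  then have "card (blk (Suc n) x) = b ^ Suc n"
    using \<open>card ?C = b\<close> unfolding eq by simp
  moreover have "finite (blk (Suc n) x)"
    unfolding eq using \<open>finite ?C\<close> fc by blast
  ultimately show ?case by blast
qed

lemma finite_blk[simp]: "x \<in> V \<Longrightarrow> finite (blk n x)"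
  and card_blk: "x \<in> V \<Longrightarrow> card (blk n x) = b ^ n"
  using finite_card_blk by auto

lemma card_subblocks:
  assumes "z \<in> V" "m \<le> n"
  shows "card (blk m ` blk n z) = b ^ (n - m)"
proof -
  have V: "x \<in> V" if "x \<in> blk n z" for x using that blk_subset by blast
  have "blk n z = (\<Union>B\<in>blk m ` blk n z. B)"
  proof (intro equalityI subsetI)
    fix x assume "x \<in> blk n z"
    then show "x \<in> (\<Union>B\<in>blk m ` blk n z. B)" using blk_refl[OF V] by auto
  next
    fix x assume "x \<in> (\<Union>B\<in>blk m ` blk n z. B)"
    then show "x \<in> blk n z" using blk_nested[OF assms(2)] by auto
  qed
  then have "b ^ n = card (\<Union>B\<in>blk m ` blk n z. B)"
    using card_blk[OF assms(1)] by metis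
  also have "\<dots> = (\<Sum>B\<in>blk m ` blk n z. card B)"
    using assms V blk_disjoint by (intro card_UN_disjoint) auto
  also have "\<dots> = (\<Sum>B\<in>blk m ` blk n z. b ^ m)"
    by (intro sum.cong) (auto simp: card_blk V)
  also have "\<dots> = card (blk m ` blk n z) * b ^ m" by simp
  finally have "card (blk m ` blk n z) * b ^ m = b ^ (n - m) * b ^ m"
    using assms(2) by (simp flip: power_add)
  then show ?thesis using b_ge_2 L_ge_2 by simp
qed

lemma lev_le: "x \<in> V \<Longrightarrow> y \<in> blk n x \<Longrightarrow> lev x y \<le> n"
  using in_blk_iff blk_subset by blast

text \<open>Shell by shell: the \<open>j\<close>-block contributes \<open>b^j / b^(2j)\<close>, and
  each further shell of level \<open>i\<close> contributes
  \<open>(b^i - b^(i-1)) / b^(2i) = b^(-i) - b^(-i-1)\<close>, which telescopes. Truncation caps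
  every term at \<open>b^(-2j)\<close>, so deleting vertices from the sum has a controlled cost; the
  cut estimate relies on this.\<close>

lemma sum_truncated_kernel:
  assumes x: "x \<in> V" and "j \<le> N"
  shows "(\<Sum>y\<in>blk N x. 1 / real b ^ (2 * max (lev x y) j)) =
    1 / real b ^ j + 1 / real b ^ (j + 1) - 1 / real b ^ (N + 1)"
  using \<open>j \<le> N\<close>
proof (induction rule: dec_induct)
  case base
  have "(\<Sum>y\<in>blk j x. 1 / real b ^ (2 * max (lev x y) j)) = (\<Sum>y\<in>blk j x. 1 / real b ^ (2 * j))"
    using lev_le[OF x] by (intro sum.cong) (simp_all add: max_absorb2)
  also have "\<dots> = real b ^ j / real b ^ (j + j)" using x by (simp add: card_blk mult_2)
  also have "\<dots> = 1 / real b ^ j" using b_ge_2 by (simp add: power_add del: of_nat_power)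
  finally show ?case by simp
next
  case (step N)
  let ?S = "blk (Suc N) x - blk N x"
  have lev: "lev x y = Suc N" if "y \<in> ?S" for y
    using that x in_blk_iff[of x y N] lev_le[of x y "Suc N"] blk_subset[of "Suc N" x]
    by (metis DiffD1 DiffD2 le_SucE subsetD)
  have "card ?S = b ^ Suc N - b ^ N"
    using x blk_mono[of N "Suc N" x] by (simp add: card_Diff_subset card_blk)
  then have cS: "real (card ?S) = real b ^ Suc N - real b ^ N"
    using b_ge_2 by (simp add: of_nat_diff)
  have "(\<Sum>y\<in>blk (Suc N) x. 1 / real b ^ (2 * max (lev x y) j)) =
     (\<Sum>y\<in>?S. 1 / real b ^ (2 * max (lev x y) j)) + (\<Sum>y\<in>blk N x. 1 / real b ^ (2 * max (lev x y) j))"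
    using x blk_mono[of N "Suc N" x] by (intro sum.subset_diff) auto
  also have "(\<Sum>y\<in>?S. 1 / real b ^ (2 * max (lev x y) j)) = (\<Sum>y\<in>?S. 1 / real b ^ (2 * Suc N))"
    using step by (intro sum.cong) (auto simp: lev max_def)
  also have "\<dots> = (real b ^ Suc N - real b ^ N) / real b ^ (2 * Suc N)"
    using cS by simp
  also have "\<dots> = 1 / real b ^ (N + 1) - 1 / real b ^ (Suc N + 1)"
  proof -
    have "B > 0 \<Longrightarrow> (B ^ Suc N - B ^ N) / B ^ (2 * Suc N) = 1 / B ^ (N + 1) - 1 / B ^ (Suc N + 1)" for B :: real
      by (simp add: field_simps power_add mult_2 mult_2_right)
    then show ?thesis using b_ge_2 by (metis of_nat_0_less_iff pos2 order_less_le_trans)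
  qed
  finally show ?case unfolding step.IH by linarith
qed

end

section \<open>Clusters inside blocks\<close>

text \<open>The value type is arbitrary, so that random sets and cardinalities are covered as well
  as events. All functions are compared, also those outside the extensional product space.\<close>

definition determined :: "'i set \<Rightarrow> (('i \<Rightarrow> bool) \<Rightarrow> 'a) \<Rightarrow> bool" where
  "determined K E \<longleftrightarrow> (\<forall>\<omega> \<omega>'. (\<forall>i\<in>K. \<omega> i = \<omega>' i) \<longrightarrow> E \<omega> = E \<omega>')"

lemma determinedI:
  assumes "\<And>\<omega> \<omega>'. (\<And>i. i \<in> K \<Longrightarrow> \<omega> i = \<omega>' i) \<Longrightarrow> E \<omega> = E \<omega>'"
  shows "determined K E"
  unfolding determined_def by (intro allI impI assms) blast

lemma determinedD:
  assumes "determined K E" "\<And>i. i \<in> K \<Longrightarrow> \<omega> i = \<omega>' i"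
  shows "E \<omega> = E \<omega>'"
  using assms unfolding determined_def by blast

lemma determined_mono: "determined K E \<Longrightarrow> K \<subseteq> K' \<Longrightarrow> determined K' E"
  unfolding determined_def by blast

lemma determined_comp: "determined K E \<Longrightarrow> determined K (\<lambda>\<omega>. f (E \<omega>))"
  unfolding determined_def by metis

lemma determined_bex:
  "(\<And>x. x \<in> X \<Longrightarrow> determined K (E x)) \<Longrightarrow> determined K (\<lambda>\<omega>. \<exists>x\<in>X. E x \<omega>)"
  unfolding determined_def by metis

lemma determined_card:
  fixes E :: "'x \<Rightarrow> ('i \<Rightarrow> bool) \<Rightarrow> bool"
  assumes "\<And>x. x \<in> X \<Longrightarrow> determined K (E x)"
  shows "determined K (\<lambda>\<omega>. card {x\<in>X. E x \<omega>})"
proof (rule determinedI)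
  fix \<omega> \<omega>' :: "'i \<Rightarrow> bool" assume *: "\<And>i. i \<in> K \<Longrightarrow> \<omega> i = \<omega>' i"
  have "{x\<in>X. E x \<omega>} = {x\<in>X. E x \<omega>'}"
    using determinedD[OF assms, of _ \<omega> \<omega>'] * by blast
  then show "card {x\<in>X. E x \<omega>} = card {x\<in>X. E x \<omega>'}" by simp
qed

context hierarchical
begin

definition conn :: "hvert set \<Rightarrow> (hvert + hvert set \<Rightarrow> bool) \<Rightarrow> (hvert \<times> hvert) set" where
  "conn U \<omega> = open_edge_rel L d \<omega> \<inter> U \<times> U"

text \<open>The closure is reflexive, so a closed vertex still has the singleton cluster
  \<open>{x}\<close>; clusters with more than one vertex consist of open vertices.\<close>

definition cl :: "hvert set \<Rightarrow> (hvert + hvert set \<Rightarrow> bool) \<Rightarrow> hvert \<Rightarrow> hvert set" where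
  "cl U \<omega> x = {y. (x, y) \<in> (conn U \<omega>)\<^sup>*}"

definition coords :: "hvert set \<Rightarrow> (hvert + hvert set) set" where
  "coords U = Inl ` U \<union> Inr ` {{x, y} | x y. x \<in> U \<and> y \<in> U \<and> x \<noteq> y}"

lemma sym_conn: "sym (conn U \<omega>)"
  by (auto simp: sym_def conn_def open_edge_rel_def insert_commute)

lemma cl_refl: "x \<in> cl U \<omega> x"
  by (simp add: cl_def)

lemma cl_sym: "y \<in> cl U \<omega> x \<Longrightarrow> x \<in> cl U \<omega> y"
  using sym_rtrancl[OF sym_conn] by (auto simp: cl_def sym_def)

lemma cl_eq: "y \<in> cl U \<omega> x \<Longrightarrow> cl U \<omega> y = cl U \<omega> x"
  using cl_sym[of y U \<omega> x] by (auto simp: cl_def intro: rtrancl_trans)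

lemma cl_subset:
  assumes "x \<in> U" shows "cl U \<omega> x \<subseteq> U"
proof
  fix y assume "y \<in> cl U \<omega> x"
  then have "(x, y) \<in> (conn U \<omega>)\<^sup>*" by (simp add: cl_def)
  then show "y \<in> U" using assms by cases (auto simp: conn_def)
qed

lemma cl_mono: "U \<subseteq> W \<Longrightarrow> cl U \<omega> x \<subseteq> cl W \<omega> x"
  using rtrancl_mono[of "conn U \<omega>" "conn W \<omega>"] by (auto simp: cl_def conn_def)

lemma cl_open:
  assumes "1 < card (cl U \<omega> x)"
  shows "\<omega> (Inl x)"
proof -
  have "cl U \<omega> x \<noteq> {x}" using assms by auto
  then obtain y where "(x, y) \<in> (conn U \<omega>)\<^sup>*" "y \<noteq> x"
    using cl_refl[of x U \<omega>] by (auto simp: cl_def)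
  then show ?thesis
    by (cases rule: converse_rtranclE) (auto simp: conn_def open_edge_rel_def)
qed

lemma cl_step:
  assumes "y \<in> cl U \<omega> x" "y \<in> U" "z \<in> U" "U \<subseteq> V" "y \<noteq> z"
    and "\<omega> (Inl y)" "\<omega> (Inl z)" "\<omega> (Inr {y, z})"
  shows "z \<in> cl U \<omega> x"
proof -
  have "(y, z) \<in> conn U \<omega>"
    using assms by (auto simp: conn_def open_edge_rel_def hedges_def)
  then show ?thesis using assms(1) by (auto simp: cl_def intro: rtrancl_into_rtrancl)
qed

section \<open>Coordinates on which a cluster depends\<close>

lemma Inl_coords: "x \<in> U \<Longrightarrow> Inl x \<in> coords U"
  unfolding coords_def by (intro UnI1 imageI)

lemma Inr_coords: "x \<in> U \<Longrightarrow> y \<in> U \<Longrightarrow> x \<noteq> y \<Longrightarrow> Inr {x, y} \<in> coords U"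
  unfolding coords_def by (rule UnI2, rule imageI) blast

lemma finite_coords:
  assumes "finite U"
  shows "finite (coords U)"
proof -
  have "{{x, y} | x y. x \<in> U \<and> y \<in> U \<and> x \<noteq> y} \<subseteq> (\<lambda>(x, y). {x, y}) ` (U \<times> U)" by auto
  then have "finite {{x, y} | x y. x \<in> U \<and> y \<in> U \<and> x \<noteq> y}"
    by (rule finite_subset) (simp add: assms)
  then show ?thesis by (simp add: coords_def assms)
qed

lemma coords_subset_hindex: "U \<subseteq> V \<Longrightarrow> coords U \<subseteq> hindex L d"
  unfolding coords_def hindex_def hedges_def by (intro Un_mono image_mono Collect_mono) blast+

lemma coords_mono: "U \<subseteq> W \<Longrightarrow> coords U \<subseteq> coords W"
  unfolding coords_def by (intro Un_mono image_mono Collect_mono) blast+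

lemma coordsE:
  assumes "i \<in> coords U"
  obtains x where "i = Inl x" "x \<in> U"
  | x y where "i = Inr {x, y}" "x \<in> U" "y \<in> U" "x \<noteq> y"
  using assms unfolding coords_def by blast

lemma coords_disjoint:
  assumes "U \<inter> W = {}"
  shows "coords U \<inter> coords W = {}"
proof -
  have False if i: "i \<in> coords U" and j: "i \<in> coords W" for i
    using i
  proof (cases rule: coordsE)
    case (1 x)
    with j show ?thesis using assms by (cases rule: coordsE) auto
  next
    case (2 x y)
    from j show ?thesis
    proof (cases rule: coordsE)
      case (2 u v)
      then have "{u, v} = {x, y}" using \<open>i = Inr {x, y}\<close> by simp
      then have "u \<in> {x, y}" by blast
      then show ?thesis using \<open>x \<in> U\<close> \<open>y \<in> U\<close> \<open>u \<in> W\<close> assms by blast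
    qed (use 2 in simp)
  qed
  then show ?thesis by blast
qed

lemma determined_cl: "U \<subseteq> V \<Longrightarrow> determined (coords U) (\<lambda>\<omega>. cl U \<omega> x)"
proof (rule determinedI)
  fix \<omega> \<omega>' :: "hvert + hvert set \<Rightarrow> bool"
  assume *: "\<And>i. i \<in> coords U \<Longrightarrow> \<omega> i = \<omega>' i"
  have v: "\<omega> (Inl x) = \<omega>' (Inl x)" if "x \<in> U" for x
    using * that by (simp add: coords_def)
  have e: "\<omega> (Inr {x, y}) = \<omega>' (Inr {x, y})" if "x \<in> U" "y \<in> U" "{x, y} \<in> hedges L d" for x y
  proof -
    have "x \<noteq> y" using that(3) by (auto simp: hedges_def doubleton_eq_iff)
    then have "Inr {x, y} \<in> coords U" by (intro Inr_coords that)
    then show ?thesis by (rule *)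
  qed
  have "(x, y) \<in> conn U \<omega> \<longleftrightarrow> (x, y) \<in> conn U \<omega>'" for x y
  proof (cases "x \<in> U \<and> y \<in> U \<and> {x, y} \<in> hedges L d")
    case True
    then show ?thesis using v[of x] v[of y] e[of x y] by (simp add: conn_def open_edge_rel_def)
  qed (auto simp: conn_def open_edge_rel_def)
  then have "conn U \<omega> = conn U \<omega>'" by auto
  then show "cl U \<omega> x = cl U \<omega>' x" by (simp add: cl_def)
qed

text \<open>Subtraction is truncated: for \<open>n \<le> k\<close> the threshold is 1 and every
  vertex of \<open>V\<close> is big. The condition has content only above level
  \<open>k\<close>.\<close>

definition big :: "nat \<Rightarrow> nat \<Rightarrow> (hvert + hvert set \<Rightarrow> bool) \<Rightarrow> hvert \<Rightarrow> bool" where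
  "big k n \<omega> x \<longleftrightarrow> b ^ (n - k) \<le> card (cl (blk n x) \<omega> x)"

text \<open>The window runs from the threshold of \<open>big\<close> at level \<open>n\<close> to
  the one at level \<open>n + 1\<close>. It is phrased for the whole block instead of one vertex, so
  the event is shared by all vertices of the block and depends on that block alone.\<close>

definition loss :: "nat \<Rightarrow> nat \<Rightarrow> (hvert + hvert set \<Rightarrow> bool) \<Rightarrow> hvert \<Rightarrow> bool" where
  "loss k n \<omega> z \<longleftrightarrow> (\<exists>x\<in>blk (Suc n) z. b ^ (n - k) \<le> card (cl (blk (Suc n) z) \<omega> x) \<and>
     card (cl (blk (Suc n) z) \<omega> x) < b ^ (Suc n - k))"

definition full :: "nat \<Rightarrow> (hvert + hvert set \<Rightarrow> bool) \<Rightarrow> hvert \<Rightarrow> bool" where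
  "full n \<omega> z \<longleftrightarrow> (\<forall>i\<in>coords (blk n z). \<omega> i)"

text \<open>Passing to a larger block only enlarges the cluster, so a vertex can cease to be big
  only if its cluster falls into the window of \<open>loss\<close>.\<close>

lemma big_Suc:
  assumes "x \<in> V" "big k n \<omega> x" "\<not> loss k n \<omega> x"
  shows "big k (Suc n) \<omega> x"
proof -
  have "finite (cl (blk (Suc n) x) \<omega> x)"
    by (rule finite_subset[OF cl_subset finite_blk]) (simp_all add: assms(1) blk_refl)
  then have "card (cl (blk n x) \<omega> x) \<le> card (cl (blk (Suc n) x) \<omega> x)"
    by (rule card_mono) (intro cl_mono blk_mono, simp)
  then show ?thesis
    using assms blk_refl[OF assms(1)] by (auto simp: big_def loss_def not_less)
qed

lemma big_chain:
  assumes "x \<in> V" "big k m \<omega> x" "m \<le> n" "\<And>l. m \<le> l \<Longrightarrow> l < n \<Longrightarrow> \<not> loss k l \<omega> x"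
  shows "big k n \<omega> x"
  using assms(3,4) by (induction rule: dec_induct) (auto simp: assms(2) intro: big_Suc[OF assms(1)])

lemma cl_full:
  assumes "z \<in> V" "full n \<omega> z" "x \<in> blk n z"
  shows "cl (blk n z) \<omega> x = blk n z"
proof
  show "blk n z \<subseteq> cl (blk n z) \<omega> x"
  proof
    fix y assume y: "y \<in> blk n z"
    show "y \<in> cl (blk n z) \<omega> x"
    proof (cases "y = x")
      case False
      have "x \<noteq> y" using False by simp
      note * = Inl_coords[OF assms(3)] Inl_coords[OF y] Inr_coords[OF assms(3) y this]
      note ** = *[THEN assms(2)[unfolded full_def, rule_format]]
      show ?thesis
        by (rule cl_step[OF cl_refl assms(3) y blk_subset \<open>x \<noteq> y\<close> **])
    qed (simp add: cl_refl)
  qed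
qed (use cl_subset assms in auto)

lemma big_if_full:
  assumes "x \<in> V" "full n \<omega> x"
  shows "big k n \<omega> x"
  using cl_full[OF assms blk_refl[OF assms(1)]] card_blk[OF assms(1), of n]
    power_increasing[of "n - k" n b] b_ge_2
  by (simp add: big_def)

lemma not_loss_if_full:
  assumes "z \<in> V" "full (Suc n) \<omega> z"
  shows "\<not> loss k n \<omega> z"
  using cl_full[OF assms] card_blk[OF assms(1), of "Suc n"]
    power_increasing[of "Suc n - k" "Suc n" b] b_ge_2
  by (auto simp: loss_def not_less simp del: power_Suc)

lemma determined_big:
  assumes "blk n x \<subseteq> U"
  shows "determined (coords U) (\<lambda>\<omega>. big k n \<omega> x)"
  unfolding big_def
  by (rule determined_mono[OF determined_comp[OF determined_cl[OF blk_subset]] coords_mono[OF assms]])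

lemma determined_loss: "determined (coords (blk (Suc n) z)) (\<lambda>\<omega>. loss k n \<omega> z)"
  unfolding loss_def
  by (rule determined_bex,
      rule determined_comp[OF determined_cl[OF blk_subset],
        where f="\<lambda>C. b ^ (n - k) \<le> card C \<and> card C < b ^ (Suc n - k)"])

lemma determined_full: "determined (coords (blk n z)) (\<lambda>\<omega>. full n \<omega> z)"
  by (rule determinedI) (simp add: full_def)

end

section \<open>Events depending on finitely many Bernoulli variables\<close>

locale bernoulli_product =
  fixes I :: "'i set" and p :: "'i \<Rightarrow> real"
  assumes p_nonneg: "0 \<le> p i" and p_le_1: "p i \<le> 1"
begin

definition M :: "('i \<Rightarrow> bool) measure" where
  "M = PiM I (\<lambda>i. measure_pmf (bernoulli_pmf (p i)))"

sublocale prob_space M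
  unfolding M_def by (rule prob_space_PiM) (rule measure_pmf.prob_space_axioms)

definition event :: "(('i \<Rightarrow> bool) \<Rightarrow> bool) \<Rightarrow> bool" where
  "event E \<longleftrightarrow> {\<omega> \<in> space M. E \<omega>} \<in> sets M"

definition Pr :: "(('i \<Rightarrow> bool) \<Rightarrow> bool) \<Rightarrow> real" where
  "Pr E = prob {\<omega> \<in> space M. E \<omega>}"

definition cyl :: "'i set \<Rightarrow> ('i \<Rightarrow> bool) \<Rightarrow> ('i \<Rightarrow> bool) \<Rightarrow> bool" where
  "cyl K f \<omega> \<longleftrightarrow> (\<forall>i\<in>K. \<omega> i = f i)"

lemma Pr_nonneg: "0 \<le> Pr E"
  by (simp add: Pr_def)

lemma Pr_le_1: "Pr E \<le> 1"
  by (simp add: Pr_def)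

lemma Pr_mono: "event F \<Longrightarrow> (\<And>\<omega>. E \<omega> \<Longrightarrow> F \<omega>) \<Longrightarrow> Pr E \<le> Pr F"
  unfolding Pr_def event_def by (rule finite_measure_mono) auto

lemma event_not: "event E \<Longrightarrow> event (\<lambda>\<omega>. \<not> E \<omega>)"
  unfolding event_def by (rule sets.sets_Collect_neg)

lemma event_conj: "event E \<Longrightarrow> event F \<Longrightarrow> event (\<lambda>\<omega>. E \<omega> \<and> F \<omega>)"
  unfolding event_def by (rule sets.sets_Collect_conj)

lemma event_disj: "event E \<Longrightarrow> event F \<Longrightarrow> event (\<lambda>\<omega>. E \<omega> \<or> F \<omega>)"
  unfolding event_def by (rule sets.sets_Collect_disj)

lemma event_bex: "finite X \<Longrightarrow> (\<And>x. x \<in> X \<Longrightarrow> event (E x)) \<Longrightarrow> event (\<lambda>\<omega>. \<exists>x\<in>X. E x \<omega>)"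
  unfolding event_def by (rule sets.sets_Collect_finite_Ex)

lemma Pr_not: "event E \<Longrightarrow> Pr (\<lambda>\<omega>. \<not> E \<omega>) = 1 - Pr E"
  unfolding event_def Pr_def by (rule prob_neg)

lemma Pr_disj_le: "event E \<Longrightarrow> event F \<Longrightarrow> Pr (\<lambda>\<omega>. E \<omega> \<or> F \<omega>) \<le> Pr E + Pr F"
  unfolding event_def Pr_def
  using measure_Un_le[of "{\<omega> \<in> space M. E \<omega>}" M "{\<omega> \<in> space M. F \<omega>}"]
  by (simp add: conj_disj_distribL Collect_disj_eq)

lemma Pr_bex_le:
  assumes "finite X" "\<And>x. x \<in> X \<Longrightarrow> event (E x)"
  shows "Pr (\<lambda>\<omega>. \<exists>x\<in>X. E x \<omega>) \<le> (\<Sum>x\<in>X. Pr (E x))"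
proof -
  have "{\<omega> \<in> space M. \<exists>x\<in>X. E x \<omega>} = (\<Union>x\<in>X. {\<omega> \<in> space M. E x \<omega>})" by auto
  then show ?thesis
    unfolding Pr_def using assms unfolding event_def
    by (simp add: finite_measure_subadditive_finite image_subset_iff)
qed

section \<open>Cylinders, conditioning and independence\<close>

lemma Pr_cyl:
  assumes "finite K" "K \<subseteq> I"
  shows "event (cyl K f)" and "Pr (cyl K f) = (\<Prod>i\<in>K. if f i then p i else 1 - p i)"
proof -
  let ?N = "\<lambda>i. measure_pmf (bernoulli_pmf (p i))"
  interpret N: product_prob_space ?N I by unfold_locales
  have eq: "{\<omega> \<in> space M. cyl K f \<omega>} = prod_emb I ?N K (\<Pi>\<^sub>E i\<in>K. {f i})"
    unfolding cyl_def M_def prod_emb_def using assms by (auto simp: space_PiM Pi_iff)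
  show "event (cyl K f)"
    unfolding event_def eq unfolding M_def using assms by (intro sets_PiM_I) auto
  have "Pr (cyl K f) = (\<Prod>i\<in>K. measure (?N i) {f i})"
    unfolding Pr_def eq unfolding M_def using assms by (intro N.measure_PiM_emb) auto
  also have "\<dots> = (\<Prod>i\<in>K. if f i then p i else 1 - p i)"
    using p_nonneg p_le_1 by (intro prod.cong) (auto simp: measure_pmf_single)
  finally show "Pr (cyl K f) = (\<Prod>i\<in>K. if f i then p i else 1 - p i)" .
qed

lemma Pr_cyl_conj_cyl:
  assumes "finite K" "K \<subseteq> I" "finite K'" "K' \<subseteq> I" "K \<inter> K' = {}"
  shows "Pr (\<lambda>\<omega>. cyl K f \<omega> \<and> cyl K' g \<omega>) = Pr (cyl K f) * Pr (cyl K' g)"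
proof -
  let ?h = "\<lambda>i. if i \<in> K then f i else g i"
  have "(\<lambda>\<omega>. cyl K f \<omega> \<and> cyl K' g \<omega>) = cyl (K \<union> K') ?h"
  proof
    fix \<omega>
    have "(\<forall>i\<in>K'. \<omega> i = ?h i) \<longleftrightarrow> (\<forall>i\<in>K'. \<omega> i = g i)"
      using assms(5) by (intro ball_cong) auto
    then show "(cyl K f \<omega> \<and> cyl K' g \<omega>) = cyl (K \<union> K') ?h \<omega>"
      by (simp add: cyl_def ball_Un)
  qed
  moreover have "(\<Prod>i\<in>K'. if ?h i then p i else 1 - p i) = (\<Prod>i\<in>K'. if g i then p i else 1 - p i)"
    using assms(5) by (intro prod.cong) auto
  ultimately show ?thesis
    using assms by (simp add: Pr_cyl prod.union_disjoint)
qed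

lemma finite_configurations: "finite K \<Longrightarrow> finite {f \<in> K \<rightarrow>\<^sub>E (UNIV :: bool set). E f}"
  by (rule finite_subset[of _ "K \<rightarrow>\<^sub>E UNIV"]) (auto intro: finite_PiE)

text \<open>The witness is the restriction of \<open>\<omega>\<close> to \<open>K\<close>.
  Configurations are extensional so that a finite \<open>K\<close> admits only finitely
  many.\<close>

lemma determined_decomposition:
  assumes "determined K E"
  shows "E \<omega> \<longleftrightarrow> (\<exists>f\<in>{f \<in> K \<rightarrow>\<^sub>E UNIV. E f}. cyl K f \<omega>)"
proof
  assume "E \<omega>"
  moreover have "E (restrict \<omega> K) = E \<omega>"
    by (rule determinedD[OF assms]) simp
  ultimately have "restrict \<omega> K \<in> {f \<in> K \<rightarrow>\<^sub>E UNIV. E f}" by simp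
  moreover have "cyl K (restrict \<omega> K) \<omega>" by (simp add: cyl_def)
  ultimately show "\<exists>f\<in>{f \<in> K \<rightarrow>\<^sub>E UNIV. E f}. cyl K f \<omega>" by blast
next
  assume "\<exists>f\<in>{f \<in> K \<rightarrow>\<^sub>E UNIV. E f}. cyl K f \<omega>"
  then obtain f where f: "E f" "cyl K f \<omega>" by blast
  have "E \<omega> = E f"
    by (rule determinedD[OF assms]) (use f(2) in \<open>simp add: cyl_def\<close>)
  then show "E \<omega>" using f(1) by simp
qed

lemma event_determined:
  assumes "determined K E" "finite K" "K \<subseteq> I"
  shows "event E"
proof -
  have "E = (\<lambda>\<omega>. \<exists>f\<in>{f \<in> K \<rightarrow>\<^sub>E UNIV. E f}. cyl K f \<omega>)"
    using determined_decomposition[OF assms(1)] by (intro ext)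
  moreover have "event (\<lambda>\<omega>. \<exists>f\<in>{f \<in> K \<rightarrow>\<^sub>E UNIV. E f}. cyl K f \<omega>)"
    using assms by (intro event_bex Pr_cyl(1) finite_configurations)
  ultimately show ?thesis by simp
qed

text \<open>Law of total probability: cylinders of distinct configurations on \<open>K\<close> are
  disjoint and together exhaust \<open>E\<close>.\<close>

lemma Pr_determined_conj:
  assumes E: "determined K E" "finite K" "K \<subseteq> I" and F: "event F"
  shows "Pr (\<lambda>\<omega>. E \<omega> \<and> F \<omega>) = (\<Sum>f\<in>{f \<in> K \<rightarrow>\<^sub>E UNIV. E f}. Pr (\<lambda>\<omega>. cyl K f \<omega> \<and> F \<omega>))"
proof -
  let ?C = "{f \<in> K \<rightarrow>\<^sub>E UNIV. E f}"
  let ?S = "\<lambda>f. {\<omega> \<in> space M. cyl K f \<omega> \<and> F \<omega>}"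
  have fin: "finite ?C" using E(2) by (rule finite_configurations)
  have "{\<omega> \<in> space M. E \<omega> \<and> F \<omega>} = (\<Union>f\<in>?C. ?S f)"
    using determined_decomposition[OF E(1)] by blast
  moreover have "measure M (\<Union>f\<in>?C. ?S f) = (\<Sum>f\<in>?C. measure M (?S f))"
  proof (rule finite_measure_finite_Union[OF fin])
    show "?S ` ?C \<subseteq> sets M"
      using event_conj[OF Pr_cyl(1)[OF E(2,3)] F] by (auto simp: event_def)
    show "disjoint_family_on ?S ?C"
    proof (unfold disjoint_family_on_def, intro ballI impI)
      fix f g assume fg: "f \<in> ?C" "g \<in> ?C" "f \<noteq> g"
      have "f = g" if "cyl K f \<omega>" "cyl K g \<omega>" for \<omega>
      proof (rule PiE_ext)
        show "f i = g i" if "i \<in> K" for i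
          using \<open>cyl K f \<omega>\<close> \<open>cyl K g \<omega>\<close> that by (simp add: cyl_def)
      qed (use fg in blast)+
      then show "?S f \<inter> ?S g = {}" using fg(3) by blast
    qed
  qed
  ultimately show ?thesis by (simp add: Pr_def)
qed

text \<open>Elementary form of conditioning on the coordinates in \<open>K\<close>: a bound relative
  to each cylinder inside \<open>E\<close> survives summation over the cylinders.\<close>

lemma Pr_conditional_bound:
  assumes E: "determined K E" "finite K" "K \<subseteq> I" and F: "event F" and "0 \<le> c"
    and bound: "\<And>f. E f \<Longrightarrow> Pr (\<lambda>\<omega>. cyl K f \<omega> \<and> F \<omega>) \<le> c * Pr (cyl K f)"
  shows "Pr (\<lambda>\<omega>. E \<omega> \<and> F \<omega>) \<le> c * Pr E"
proof -
  have "Pr (\<lambda>\<omega>. E \<omega> \<and> F \<omega>) \<le> (\<Sum>f\<in>{f \<in> K \<rightarrow>\<^sub>E UNIV. E f}. c * Pr (cyl K f))"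
    unfolding Pr_determined_conj[OF E F] by (rule sum_mono) (simp add: bound)
  also have "\<dots> = c * Pr (\<lambda>\<omega>. E \<omega> \<and> True)"
    using Pr_determined_conj[OF E, of "\<lambda>_. True"] by (simp add: sum_distrib_left event_def)
  finally show ?thesis by simp
qed

text \<open>Two rounds of \<open>Pr_conditional_bound\<close>, one for each event, reduce the claim
  to a pair of cylinders on disjoint coordinate sets.\<close>

lemma Pr_independent_le:
  assumes E: "determined K E" "finite K" "K \<subseteq> I"
    and F: "determined K' F" "finite K'" "K' \<subseteq> I" and disj: "K \<inter> K' = {}"
  shows "Pr (\<lambda>\<omega>. E \<omega> \<and> F \<omega>) \<le> Pr E * Pr F"
proof -
  have "Pr (\<lambda>\<omega>. E \<omega> \<and> F \<omega>) \<le> Pr F * Pr E"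
  proof (rule Pr_conditional_bound[OF E event_determined[OF F] Pr_nonneg])
    fix f
    have "Pr (\<lambda>\<omega>. F \<omega> \<and> cyl K f \<omega>) \<le> Pr (cyl K f) * Pr F"
    proof (rule Pr_conditional_bound[OF F Pr_cyl(1)[OF E(2,3)] Pr_nonneg])
      show "Pr (\<lambda>\<omega>. cyl K' g \<omega> \<and> cyl K f \<omega>) \<le> Pr (cyl K f) * Pr (cyl K' g)" for g
        using Pr_cyl_conj_cyl[OF F(2,3) E(2,3), of g f] disj by (simp add: Int_commute mult.commute)
    qed
    then show "Pr (\<lambda>\<omega>. cyl K f \<omega> \<and> F \<omega>) \<le> Pr F * Pr (cyl K f)"
      by (simp add: conj_commute mult.commute)
  qed
  then show ?thesis by (simp add: mult.commute)
qed

section \<open>Counts of events: Markov and Chebyshev bounds\<close>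

lemma
  assumes "event E"
  shows integrable_of_bool: "integrable M (\<lambda>\<omega>. of_bool (E \<omega>) :: real)"
    and expectation_of_bool: "expectation (\<lambda>\<omega>. of_bool (E \<omega>)) = Pr E"
proof -
  have eq: "of_bool (E \<omega>) = (indicator {\<omega> \<in> space M. E \<omega>} \<omega> :: real)" if "\<omega> \<in> space M" for \<omega>
    using that by (simp add: indicator_def)
  have S: "{\<omega> \<in> space M. E \<omega>} \<in> sets M" using assms by (simp add: event_def)
  show "integrable M (\<lambda>\<omega>. of_bool (E \<omega>) :: real)"
    using integrable_real_indicator[OF S] emeasure_finite
    by (subst Bochner_Integration.integrable_cong[OF refl eq]) (simp_all add: less_top[symmetric])
  show "expectation (\<lambda>\<omega>. of_bool (E \<omega>)) = Pr E"
    using S by (subst Bochner_Integration.integral_cong[OF refl eq]) (auto simp: Pr_def)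
qed

lemma card_eq_sum_of_bool: "finite X \<Longrightarrow> real (card {x\<in>X. E x \<omega>}) = (\<Sum>x\<in>X. of_bool (E x \<omega>))"
  by (simp add: sum.If_cases of_bool_def Int_def)

lemma Pr_count_Markov:
  assumes "finite X" "\<And>x. x \<in> X \<Longrightarrow> event (E x)" "0 < c"
  shows "Pr (\<lambda>\<omega>. c \<le> real (card {x\<in>X. E x \<omega>})) \<le> (\<Sum>x\<in>X. Pr (E x)) / c"
proof -
  let ?Z = "\<lambda>\<omega>. \<Sum>x\<in>X. of_bool (E x \<omega>) :: real"
  have int: "integrable M ?Z"
    using assms(2) by (intro Bochner_Integration.integrable_sum integrable_of_bool)
  have "Pr (\<lambda>\<omega>. c \<le> ?Z \<omega>) \<le> expectation ?Z / c"
    unfolding Pr_def using int assms(3)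
    by (intro integral_Markov_inequality_measure[where A="{}"]) (auto intro!: AE_I2 sum_nonneg)
  also have "expectation ?Z = (\<Sum>x\<in>X. Pr (E x))"
    using assms(2) by (subst Bochner_Integration.integral_sum)
      (auto simp: integrable_of_bool expectation_of_bool)
  finally show ?thesis by (simp add: card_eq_sum_of_bool[OF assms(1)])
qed

text \<open>\<open>N x\<close> is a dependency neighbourhood. Pairs outside it have nonpositive
  covariance and the at most \<open>s * card X\<close> pairs inside contribute at most 1 each, so
  the variance is at most \<open>s * card X\<close>. The mean is at most
  \<open>\<rho> * card X\<close>, so reaching twice that value is a deviation of at least
  \<open>\<rho> * card X\<close>.\<close>

lemma Pr_count_Chebyshev:
  fixes \<rho> :: real and s :: nat
  assumes X: "finite X" "X \<noteq> {}" and ev: "\<And>x. x \<in> X \<Longrightarrow> event (E x)"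
    and le: "\<And>x. x \<in> X \<Longrightarrow> Pr (E x) \<le> \<rho>" and "0 < \<rho>"
    and N: "\<And>x. x \<in> X \<Longrightarrow> card (X \<inter> N x) \<le> s"
    and indep: "\<And>x y. x \<in> X \<Longrightarrow> y \<in> X \<Longrightarrow> y \<notin> N x \<Longrightarrow>
      Pr (\<lambda>\<omega>. E x \<omega> \<and> E y \<omega>) \<le> Pr (E x) * Pr (E y)"
  shows "Pr (\<lambda>\<omega>. 2 * \<rho> * card X \<le> real (card {x\<in>X. E x \<omega>})) \<le> s / (\<rho>\<^sup>2 * card X)"
proof -
  let ?Z = "\<lambda>\<omega>. \<Sum>x\<in>X. of_bool (E x \<omega>) :: real"
  let ?\<mu> = "\<Sum>x\<in>X. Pr (E x)"
  let ?c = "\<rho> * card X"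
  have c: "0 < ?c" using X \<open>0 < \<rho>\<close> by (simp add: card_gt_0_iff)
  have int: "integrable M ?Z"
    using ev by (intro Bochner_Integration.integrable_sum integrable_of_bool)
  have EZ: "expectation ?Z = ?\<mu>"
    using ev by (subst Bochner_Integration.integral_sum)
      (auto simp: integrable_of_bool expectation_of_bool)
  have Z2: "(?Z \<omega>)\<^sup>2 = (\<Sum>x\<in>X. \<Sum>y\<in>X. of_bool (E x \<omega> \<and> E y \<omega>))" for \<omega>
    by (simp add: power2_eq_square sum_product of_bool_conj)
  have ev2: "event (\<lambda>\<omega>. E x \<omega> \<and> E y \<omega>)" if "x \<in> X" "y \<in> X" for x y
    using that ev by (intro event_conj)
  have int2: "integrable M (\<lambda>\<omega>. (?Z \<omega>)\<^sup>2)"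
    unfolding Z2 by (intro Bochner_Integration.integrable_sum integrable_of_bool ev2)
  have "expectation (\<lambda>\<omega>. (?Z \<omega>)\<^sup>2) = (\<Sum>x\<in>X. \<Sum>y\<in>X. Pr (\<lambda>\<omega>. E x \<omega> \<and> E y \<omega>))"
    unfolding Z2
    by (simp add: Bochner_Integration.integral_sum Bochner_Integration.integrable_sum
        integrable_of_bool expectation_of_bool ev2 del: of_bool_conj)
  also have "\<dots> \<le> (\<Sum>x\<in>X. real s + (\<Sum>y\<in>X. Pr (E x) * Pr (E y)))"
  proof (rule sum_mono)
    fix x assume x: "x \<in> X"
    have "(\<Sum>y\<in>X. Pr (\<lambda>\<omega>. E x \<omega> \<and> E y \<omega>)) \<le> (\<Sum>y\<in>X. of_bool (y \<in> N x) + Pr (E x) * Pr (E y))"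
    proof (rule sum_mono)
      fix y assume y: "y \<in> X"
      show "Pr (\<lambda>\<omega>. E x \<omega> \<and> E y \<omega>) \<le> of_bool (y \<in> N x) + Pr (E x) * Pr (E y)"
        using indep[OF x y] Pr_le_1[of "\<lambda>\<omega>. E x \<omega> \<and> E y \<omega>"] Pr_nonneg[of "E x"] Pr_nonneg[of "E y"]
        by (cases "y \<in> N x") (auto intro: add_increasing2)
    qed
    also have "\<dots> = card (X \<inter> N x) + (\<Sum>y\<in>X. Pr (E x) * Pr (E y))"
      using X by (simp add: sum.distrib sum.If_cases of_bool_def)
    finally show "(\<Sum>y\<in>X. Pr (\<lambda>\<omega>. E x \<omega> \<and> E y \<omega>)) \<le> real s + (\<Sum>y\<in>X. Pr (E x) * Pr (E y))"
      using N[OF x] by linarith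
  qed
  also have "\<dots> = s * card X + ?\<mu>\<^sup>2"
    by (simp add: sum.distrib power2_eq_square sum_product)
  finally have "variance ?Z \<le> s * card X"
    using variance_eq[OF int int2] EZ by simp
  have "Pr (\<lambda>\<omega>. 2 * \<rho> * card X \<le> ?Z \<omega>) \<le> Pr (\<lambda>\<omega>. ?c \<le> \<bar>?Z \<omega> - expectation ?Z\<bar>)"
  proof (rule Pr_mono)
    show "event (\<lambda>\<omega>. ?c \<le> \<bar>?Z \<omega> - expectation ?Z\<bar>)"
      unfolding event_def using int by measurable
    have "?\<mu> \<le> ?c" using sum_mono[of X "\<lambda>x. Pr (E x)" "\<lambda>_. \<rho>", OF le] by (simp add: mult.commute)
    then show "?c \<le> \<bar>?Z \<omega> - expectation ?Z\<bar>" if "2 * \<rho> * card X \<le> ?Z \<omega>" for \<omega>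
      using that unfolding EZ mult.assoc[of 2] by linarith
  qed
  also have "\<dots> \<le> variance ?Z / ?c\<^sup>2"
    unfolding Pr_def by (rule Chebyshev_inequality[OF _ int2 c]) (use int in measurable)
  also have "\<dots> \<le> s * card X / ?c\<^sup>2"
    using \<open>variance ?Z \<le> s * card X\<close> c by (intro divide_right_mono) auto
  also have "\<dots> = s / (\<rho>\<^sup>2 * card X)"
    using c by (simp add: power2_eq_square)
  finally show ?thesis by (simp add: card_eq_sum_of_bool[OF X(1)])
qed

end

section \<open>Unions of block clusters and their cuts\<close>

context hierarchical
begin

definition inner_cl :: "nat \<Rightarrow> (hvert + hvert set \<Rightarrow> bool) \<Rightarrow> hvert \<Rightarrow> hvert set" where
  "inner_cl m \<omega> x = cl (blk m x) \<omega> x"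

lemma inner_cl_refl: "x \<in> inner_cl m \<omega> x"
  by (simp add: inner_cl_def cl_refl)

lemma inner_cl_subset: "x \<in> V \<Longrightarrow> inner_cl m \<omega> x \<subseteq> blk m x"
  unfolding inner_cl_def by (intro cl_subset blk_refl)

lemma inner_cl_eq:
  assumes "x \<in> V" "y \<in> inner_cl m \<omega> x"
  shows "inner_cl m \<omega> y = inner_cl m \<omega> x"
proof -
  have "blk m y = blk m x" using inner_cl_subset[OF assms(1)] assms(2) by (intro blk_eq) blast
  then show ?thesis using assms(2) unfolding inner_cl_def by (simp add: cl_eq)
qed

definition bigs :: "nat \<Rightarrow> nat \<Rightarrow> hvert set \<Rightarrow> (hvert + hvert set \<Rightarrow> bool) \<Rightarrow> hvert set" where
  "bigs k m U \<omega> = {x \<in> U. big k m \<omega> x}"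

text \<open>Candidates for a separated cluster: unions of whole big \<open>m\<close>-clusters,
  encoded as sets of big vertices closed under taking \<open>m\<close>-clusters.\<close>

definition unions :: "nat \<Rightarrow> nat \<Rightarrow> hvert set \<Rightarrow> (hvert + hvert set \<Rightarrow> bool) \<Rightarrow> hvert set set" where
  "unions k m U \<omega> = {A. A \<subseteq> bigs k m U \<omega> \<and> (\<forall>x\<in>A. inner_cl m \<omega> x \<subseteq> A)}"

text \<open>Big \<open>m\<close>-clusters are disjoint and have at least \<open>b^(m-k)\<close>
  vertices, so an \<open>n\<close>-block holds at most \<open>b^(n-m+k)\<close> of them, and a
  candidate is determined by the clusters it contains. The bound stays constant when
  \<open>m\<close> trails \<open>n\<close> by a fixed gap.\<close>

lemma card_unions:
  assumes z: "z \<in> V" and "m \<le> n" "k \<le> m"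
  shows "finite (unions k m (blk n z) \<omega>)" "card (unions k m (blk n z) \<omega>) \<le> 2 ^ (b ^ (n - m + k))"
proof -
  let ?F = "bigs k m (blk n z) \<omega>"
  let ?C = "inner_cl m \<omega> ` ?F"
  have FB: "?F \<subseteq> blk n z" by (auto simp: bigs_def)
  have FV: "x \<in> V" if "x \<in> ?F" for x using FB blk_subset that by blast
  have finF: "finite ?F" using FB z finite_subset by (metis finite_blk)
  then have finC: "finite ?C" by simp
  have sub: "unions k m (blk n z) \<omega> \<subseteq> Pow ?F" by (auto simp: unions_def)
  show "finite (unions k m (blk n z) \<omega>)"
    by (rule finite_subset[OF sub]) (simp add: finF)
  have CB: "C \<subseteq> blk n z" if "C \<in> ?C" for C
    using that FB FV inner_cl_subset blk_nested[OF assms(2)] by blast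
  have "card ?C * b ^ (m - k) = (\<Sum>C\<in>?C. b ^ (m - k))" by simp
  also have "\<dots> \<le> (\<Sum>C\<in>?C. card C)"
    by (intro sum_mono) (auto simp: bigs_def big_def inner_cl_def)
  also have "\<dots> = card (\<Union>C\<in>?C. C)"
  proof (rule card_UN_disjoint[symmetric, OF finC])
    show "\<forall>C\<in>?C. finite C" using CB finite_subset[OF _ finite_blk[OF z]] by blast
    show "\<forall>C\<in>?C. \<forall>C'\<in>?C. C \<noteq> C' \<longrightarrow> C \<inter> C' = {}"
      using inner_cl_eq FV by blast
  qed
  also have "\<dots> \<le> card (blk n z)"
    using CB z by (intro card_mono) auto
  also have "\<dots> = b ^ (n - m + k) * b ^ (m - k)"
    using assms by (simp add: card_blk flip: power_add)
  finally have cC: "card ?C \<le> b ^ (n - m + k)" using L_ge_2 by simp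
  have "inj_on (\<lambda>A. inner_cl m \<omega> ` A) (unions k m (blk n z) \<omega>)"
  proof (rule inj_on_inverseI)
    fix A assume "A \<in> unions k m (blk n z) \<omega>"
    then show "\<Union>(inner_cl m \<omega> ` A) = A"
      using inner_cl_refl by (force simp: unions_def)
  qed
  moreover have "(\<lambda>A. inner_cl m \<omega> ` A) ` unions k m (blk n z) \<omega> \<subseteq> Pow ?C"
    by (auto simp: unions_def)
  ultimately have "card (unions k m (blk n z) \<omega>) \<le> card (Pow ?C)"
    using finC by (intro card_inj_on_le) auto
  also have "\<dots> = 2 ^ card ?C" using finC by (simp add: card_Pow)
  also have "\<dots> \<le> 2 ^ (b ^ (n - m + k))" using cC by (intro power_increasing) auto
  finally show "card (unions k m (blk n z) \<omega>) \<le> 2 ^ (b ^ (n - m + k))" .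
qed

text \<open>\<open>A\<close> is the lost cluster cut down to the vertices that are big at level
  \<open>m\<close>; what is discarded is counted among the vertices that are not big. Since
  \<open>k < m\<close>, big vertices are open, so an open edge from \<open>A\<close> to another big
  vertex would extend the cluster.\<close>

lemma loss_separates:
  assumes z: "z \<in> V" and m: "k < m" "m \<le> n" and "loss k n \<omega> z"
  obtains A where "A \<in> unions k m (blk (Suc n) z) \<omega>"
    and "b ^ (n - k) \<le> card A + card (blk (Suc n) z - bigs k m (blk (Suc n) z) \<omega>)"
    and "card A \<le> b ^ (Suc n - k)"
    and "\<And>x y. x \<in> A \<Longrightarrow> y \<in> bigs k m (blk (Suc n) z) \<omega> - A \<Longrightarrow> \<not> \<omega> (Inr {x, y})"
proof -
  let ?B = "blk (Suc n) z"
  let ?F = "bigs k m ?B \<omega>"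
  obtain x0 where x0: "x0 \<in> ?B" "b ^ (n - k) \<le> card (cl ?B \<omega> x0)" "card (cl ?B \<omega> x0) < b ^ (Suc n - k)"
    using assms(4) by (auto simp: loss_def)
  let ?C = "cl ?B \<omega> x0"
  let ?A = "?C \<inter> ?F"
  have CB: "?C \<subseteq> ?B" using x0(1) by (rule cl_subset)
  have finB: "finite ?B" using z by simp
  have finC: "finite ?C" using CB finB by (rule finite_subset)
  have V: "x \<in> V" if "x \<in> ?B" for x using that blk_subset by blast
  have inner: "inner_cl m \<omega> x \<subseteq> cl ?B \<omega> x" if "x \<in> ?B" for x
    unfolding inner_cl_def using that m by (intro cl_mono blk_nested) auto
  have opn: "\<omega> (Inl x)" if "x \<in> ?F" for x
  proof (rule cl_open)
    have "1 < b ^ (m - k)" by (rule one_less_power) (use b_ge_2 m in linarith)+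
    then show "1 < card (cl (blk m x) \<omega> x)" using that by (simp add: bigs_def big_def)
  qed
  show ?thesis
  proof (rule that[of ?A])
    have "inner_cl m \<omega> x \<subseteq> ?A" if "x \<in> ?A" for x
    proof
      fix y assume y: "y \<in> inner_cl m \<omega> x"
      have x: "x \<in> ?B" "x \<in> V" using that CB V by auto
      have yC: "y \<in> ?C" using y inner[OF x(1)] cl_eq[of x ?B \<omega> x0] that by auto
      have "card (inner_cl m \<omega> y) = card (inner_cl m \<omega> x)" using inner_cl_eq[OF x(2) y] by simp
      then show "y \<in> ?A"
        using yC CB that by (auto simp: bigs_def big_def inner_cl_def)
    qed
    then show "?A \<in> unions k m ?B \<omega>" by (auto simp: unions_def)
    have "card ?C \<le> card (?A \<union> (?B - ?F))"
      using CB finB finC by (intro card_mono) auto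
    then show "b ^ (n - k) \<le> card ?A + card (?B - ?F)"
      using x0(2) card_Un_le[of ?A "?B - ?F"] by linarith
    have "card ?A \<le> card ?C" using finC by (intro card_mono) auto
    then show "card ?A \<le> b ^ (Suc n - k)" using x0(3) by linarith
    fix x y assume x: "x \<in> ?A" and y: "y \<in> ?F - ?A"
    have xy: "x \<in> ?B" "y \<in> ?B" "x \<noteq> y" using x y by (auto simp: bigs_def)
    show "\<not> \<omega> (Inr {x, y})"
    proof
      assume "\<omega> (Inr {x, y})"
      then have "y \<in> ?C"
        using cl_step[of x ?B \<omega> x0 y, OF _ xy(1,2) blk_subset xy(3)] opn x y by blast
      then show False using y by blast
    qed
  qed
qed

section \<open>Isoperimetry: the weight of edges leaving a candidate\<close>

text \<open>With \<open>\<beta> = \<alpha> / R\<close> the main term is \<open>\<beta> (1 + 1/B - \<beta>/B) = 1 - (1 - \<beta>) (1 - \<beta>/B)\<close>, so on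
  \<open>1 \<le> \<beta> \<le> B\<close> it is smallest at the end points, where \<open>A\<close> is a whole block.\<close>
lemma cut_algebra:
  fixes \<alpha> R B K \<eta> \<epsilon> :: real
  assumes "2 \<le> B" "0 < R" "0 < K" "1 / K \<le> \<epsilon>" "\<eta> \<le> \<epsilon> * R" "(1 - \<epsilon>) * R \<le> \<alpha>" "\<alpha> \<le> B * R"
    "0 \<le> \<alpha>"
  shows "1 - 3 * \<epsilon> \<le> \<alpha> * B * (1 / (B * R) + 1 / (B * (B * R)) - 1 / (B * B * K * R)
    - (\<alpha> + \<eta>) * (1 / ((B * R) * (B * R))))"
proof -
  define \<beta> where "\<beta> = \<alpha> / R"
  define v where "v = \<eta> / R"
  define u where "u = 1 / K"
  have u: "u \<le> \<epsilon>" "0 < u" and v: "v \<le> \<epsilon>"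
    using assms by (auto simp: u_def v_def divide_simps)
  have \<beta>: "1 - \<epsilon> \<le> \<beta>" "\<beta> \<le> B" "0 \<le> \<beta>" using assms by (auto simp: \<beta>_def divide_simps)
  have \<beta>B: "0 \<le> \<beta> / B" "\<beta> / B \<le> 1" using \<beta> assms(1) by (auto simp: divide_simps)
  have "\<beta> / B * u \<le> 1 * \<epsilon>" "\<beta> / B * v \<le> \<epsilon>"
  proof -
    show "\<beta> / B * u \<le> 1 * \<epsilon>" using u \<beta>B by (intro mult_mono) auto
    have "\<beta> / B * v \<le> \<beta> / B * \<epsilon>" using v \<beta>B by (intro mult_left_mono) auto
    also have "\<dots> \<le> 1 * \<epsilon>" using \<beta>B u by (intro mult_right_mono) auto
    finally show "\<beta> / B * v \<le> \<epsilon>" by simp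
  qed
  moreover have "(1 - \<beta>) * (1 - \<beta> / B) \<le> \<epsilon>"
  proof (cases "1 \<le> \<beta>")
    case True
    then have "(1 - \<beta>) * (1 - \<beta> / B) \<le> 0" using \<beta>B by (intro mult_nonpos_nonneg) auto
    then show ?thesis using u by linarith
  next
    case False
    then have "(1 - \<beta>) * (1 - \<beta> / B) \<le> 1 - \<beta>" using \<beta>B by (intro mult_left_le) auto
    then show ?thesis using \<beta>(1) by linarith
  qed
  moreover have "\<alpha> * B * (1 / (B * R) + 1 / (B * (B * R)) - 1 / (B * B * K * R) - (\<alpha> + \<eta>) * (1 / ((B * R) * (B * R))))
     = 1 - (1 - \<beta>) * (1 - \<beta> / B) - \<beta> / B * u - \<beta> / B * v"
    using assms unfolding \<beta>_def u_def v_def by (simp add: field_simps)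
  ultimately show ?thesis by linarith
qed

text \<open>Seen from a vertex of \<open>A\<close>, the whole block carries the weight computed in
  \<open>sum_truncated_kernel\<close>. Excluded are only \<open>A\<close> itself, the vertices
  outside \<open>F\<close> and the vertex's own \<open>m\<close>-block, and each excluded vertex
  costs at most \<open>b^(-2j)\<close>. The truncation level \<open>j\<close> is that of a block of
  the largest size allowed for \<open>A\<close>.\<close>

lemma cut_lower_bound:
  fixes J :: "hvert set \<Rightarrow> real" and \<epsilon> g :: real
  assumes z: "z \<in> V" and mk: "m + k \<le> n" and "0 \<le> g"
    and J: "\<And>x y l. x \<in> V \<Longrightarrow> y \<in> blk l x \<Longrightarrow> y \<notin> blk m x \<Longrightarrow> g * b / real b ^ (2 * l) \<le> J {x, y}"
    and AF: "A \<subseteq> F" "F \<subseteq> blk (Suc n) z"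
    and k: "1 / real b ^ k \<le> \<epsilon>"
    and eta: "real (card (blk (Suc n) z - F)) + real b ^ m \<le> \<epsilon> * real b ^ (n - k)"
    and A1: "(1 - \<epsilon>) * real b ^ (n - k) \<le> card A" and A2: "card A \<le> b ^ (Suc n - k)"
  shows "(1 - 3 * \<epsilon>) * g \<le> (\<Sum>x\<in>A. \<Sum>y\<in>F - A - blk m x. J {x, y})"
proof -
  define j where "j = Suc (n - k)"
  define B where "B = real b"
  have B: "2 \<le> B" unfolding B_def by (metis b_ge_2 of_nat_le_iff of_nat_numeral)
  let ?B = "blk (Suc n) z"
  let ?w = "\<lambda>x y. 1 / B ^ (2 * max (lev x y) j)"
  let ?\<eta> = "real (card (?B - F)) + B ^ m"
  let ?S = "1 / B ^ j + 1 / B ^ (j + 1) - 1 / B ^ (Suc n + 1) - (card A + ?\<eta>) * (1 / B ^ (2 * j))"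
  have finB: "finite ?B" using z by simp
  have finA: "finite A" using finB AF finite_subset by (metis subset_trans)
  have per_vertex: "g * B * ?S \<le> (\<Sum>y\<in>F - A - blk m x. J {x, y})" if "x \<in> A" for x
  proof -
    have xB: "x \<in> ?B" using that AF by blast
    then have x: "x \<in> V" using blk_subset by blast
    have Bx: "blk (Suc n) x = ?B" using xB by (rule blk_eq)
    let ?T = "F - A - blk m x"
    let ?U = "A \<union> (?B - F) \<union> blk m x"
    have finU: "finite ?U" using finA finB x by simp
    have T: "?T \<subseteq> ?B" using AF by auto
    then have finT: "finite ?T" using finB by (rule finite_subset)
    have "?B \<subseteq> ?T \<union> ?U" by auto
    have "(\<Sum>y\<in>?B. ?w x y) \<le> (\<Sum>y\<in>?T \<union> ?U. ?w x y)"
      using B by (intro sum_mono2 finite_UnI finT finU) auto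
    also have "\<dots> \<le> (\<Sum>y\<in>?T. ?w x y) + (\<Sum>y\<in>?U. ?w x y)"
      using sum.union_inter[OF finT finU, of "?w x"] sum_nonneg[of "?T \<inter> ?U" "?w x"] B by auto
    also have "(\<Sum>y\<in>?U. ?w x y) \<le> (\<Sum>y\<in>?U. 1 / B ^ (2 * j))"
      using B by (intro sum_mono divide_left_mono power_increasing) auto
    also have "\<dots> = card ?U * (1 / B ^ (2 * j))" by simp
    also have "\<dots> \<le> (card A + ?\<eta>) * (1 / B ^ (2 * j))"
    proof (rule mult_right_mono)
      have "card ?U \<le> card A + card (?B - F) + card (blk m x)"
        using card_Un_le[of "A \<union> (?B - F)" "blk m x"] card_Un_le[of A "?B - F"] by linarith
      moreover have "real (card (blk m x)) = B ^ m" using card_blk[OF x] by (simp add: B_def)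
      ultimately show "real (card ?U) \<le> card A + ?\<eta>" by linarith
    qed (use B in simp)
    finally have "?S \<le> (\<Sum>y\<in>?T. ?w x y)"
      using sum_truncated_kernel[OF x, of j "Suc n"] unfolding Bx B_def j_def by simp
    then have "g * B * ?S \<le> g * B * (\<Sum>y\<in>?T. ?w x y)"
      using \<open>0 \<le> g\<close> B by (intro mult_left_mono) auto
    also have "\<dots> = (\<Sum>y\<in>?T. g * B / B ^ (2 * max (lev x y) j))"
      by (simp add: sum_distrib_left)
    also have "\<dots> \<le> (\<Sum>y\<in>?T. J {x, y})"
    proof (rule sum_mono)
      fix y assume y: "y \<in> ?T"
      have "y \<in> V" using y T blk_subset by blast
      \<comment> \<open>The hypothesis on \<open>J\<close> accepts any block around \<open>x\<close>
        that contains \<open>y\<close>, not only the smallest, so it can be applied at the truncated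
        level.\<close>
      then have "y \<in> blk (max (lev x y) j) x" using in_blk_iff[OF x] by simp
      then show "g * B / B ^ (2 * max (lev x y) j) \<le> J {x, y}"
        unfolding B_def using J[OF x] y by simp
    qed
    finally show ?thesis .
  qed
  \<comment> \<open>Here \<open>R\<close> is \<open>B^(n-k)\<close> and \<open>K\<close> is
    \<open>B^k\<close>, so that \<open>B * B * K * R\<close> is \<open>B^(n+2)\<close>, the last
    denominator in the kernel sum over the \<open>(n+1)\<close>-block.\<close>
  have "1 - 3 * \<epsilon> \<le> card A * B * (1 / (B * B ^ (n - k)) + 1 / (B * (B * B ^ (n - k))) - 1 / (B * B * B ^ k * B ^ (n - k))
     - (card A + ?\<eta>) * (1 / ((B * B ^ (n - k)) * (B * B ^ (n - k)))))"
  proof (rule cut_algebra)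
    have "Suc n - k = Suc (n - k)" using mk by simp
    then have "real (card A) \<le> real (b ^ Suc (n - k))"
      using A2 unfolding of_nat_le_iff by simp
    then show "real (card A) \<le> B * B ^ (n - k)" by (simp add: B_def)
  qed (use B k[folded B_def] eta[folded B_def] A1[folded B_def] in simp_all)
  also have "\<dots> = card A * B * ?S"
  proof -
    have "B ^ (Suc n + 1) = B ^ (2 + k + (n - k))" using mk by simp
    then have "B ^ (Suc n + 1) = B * B * B ^ k * B ^ (n - k)"
      unfolding power_add by (simp only: power2_eq_square)
    moreover have "B ^ (2 * j) = (B * B ^ (n - k)) * (B * B ^ (n - k))"
      by (simp add: j_def mult_2 power_add)
    moreover have "B ^ j = B * B ^ (n - k)" "B ^ (j + 1) = B * (B * B ^ (n - k))"
      by (simp_all add: j_def)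
    ultimately show ?thesis by (simp only:)
  qed
  finally have "(1 - 3 * \<epsilon>) * g \<le> card A * B * ?S * g"
    using \<open>0 \<le> g\<close> by (rule mult_right_mono)
  also have "\<dots> = (\<Sum>x\<in>A. g * B * ?S)" by simp
  also have "\<dots> \<le> (\<Sum>x\<in>A. \<Sum>y\<in>F - A - blk m x. J {x, y})"
    using per_vertex by (rule sum_mono)
  finally show ?thesis .
qed

end

section \<open>Percolation: the probability of losing a cluster\<close>

locale percolation = hierarchical L d for L d +
  fixes q :: real and J :: "hvert set \<Rightarrow> real"
  assumes q_nonneg: "0 \<le> q" and q_le_1: "q \<le> 1" and J_nonneg: "0 \<le> J e"
begin

definition open_prob :: "hvert + hvert set \<Rightarrow> real" where
  "open_prob i = (case i of Inl v \<Rightarrow> q | Inr e \<Rightarrow> 1 - exp (- J e))"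

sublocale bernoulli_product "hindex L d" open_prob
  using q_nonneg q_le_1 J_nonneg by unfold_locales (auto simp: open_prob_def split: sum.split)

lemma perc_measure_eq: "perc_measure L d q J = M"
  unfolding perc_measure_def M_def
  by (intro PiM_cong refl) (auto simp: open_prob_def split: sum.split)

lemma event_block:
  assumes "z \<in> V" "determined (coords (blk n z)) E"
  shows "event E"
  by (rule event_determined[OF assms(2) finite_coords[OF finite_blk[OF assms(1)]]
        coords_subset_hindex[OF blk_subset]])

lemma event_big: "x \<in> V \<Longrightarrow> event (\<lambda>\<omega>. big k n \<omega> x)"
  by (rule event_block[where n=n and z=x]) (simp_all add: determined_big)

lemma event_loss: "z \<in> V \<Longrightarrow> event (\<lambda>\<omega>. loss k n \<omega> z)"
  by (rule event_block[OF _ determined_loss])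

lemma event_full: "z \<in> V \<Longrightarrow> event (\<lambda>\<omega>. full n \<omega> z)"
  by (rule event_block[OF _ determined_full])

definition missing :: "nat \<Rightarrow> nat \<Rightarrow> nat \<Rightarrow> (hvert + hvert set \<Rightarrow> bool) \<Rightarrow> hvert \<Rightarrow> nat" where
  "missing k m n \<omega> z = card {x \<in> blk n z. \<not> big k m \<omega> x}"

text \<open>Only coordinates inside the \<open>m\<close>-blocks are listed. The edges between
  different \<open>m\<close>-blocks thus remain unrevealed when this count is conditioned
  on.\<close>

lemma determined_missing:
  assumes "m \<le> n"
  shows "determined (\<Union>x\<in>blk n z. coords (blk m x)) (\<lambda>\<omega>. missing k m n \<omega> z)"
  unfolding missing_def
proof (rule determined_card)
  fix x assume "x \<in> blk n z"
  then show "determined (\<Union>x\<in>blk n z. coords (blk m x)) (\<lambda>\<omega>. \<not> big k m \<omega> x)"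
    by (intro determined_comp[where f=Not] determined_mono[OF determined_big[OF subset_refl]]) auto
qed

lemma inner_coords:
  assumes "z \<in> V" "m \<le> n"
  shows "(\<Union>x\<in>blk n z. coords (blk m x)) \<subseteq> coords (blk n z)"
  by (intro UN_least coords_mono blk_nested assms)

lemma determined_missing_block:
  assumes "z \<in> V" "m \<le> n"
  shows "determined (coords (blk n z)) (\<lambda>\<omega>. missing k m n \<omega> z)"
  by (rule determined_mono[OF determined_missing[OF assms(2)] inner_coords[OF assms]])

lemma event_missing: "z \<in> V \<Longrightarrow> m \<le> n \<Longrightarrow> event (\<lambda>\<omega>. P (missing k m n \<omega> z))"
  by (rule event_block[OF _ determined_comp[OF determined_missing_block]])

text \<open>Each edge is closed with probability \<open>exp (- J e)\<close>, so independence turns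
  the product into the exponential of the total weight.\<close>

lemma Pr_edges_closed:
  assumes "D \<subseteq> hedges L d" "finite D"
  shows "Pr (cyl (Inr ` D) (\<lambda>_. False)) = exp (- (\<Sum>e\<in>D. J e))"
proof -
  have "Inr ` D \<subseteq> hindex L d" using assms(1) by (auto simp: hindex_def)
  then have "Pr (cyl (Inr ` D) (\<lambda>_. False)) = (\<Prod>i\<in>Inr ` D. 1 - open_prob i)"
    using assms(2) by (subst Pr_cyl(2)) auto
  also have "\<dots> = (\<Prod>e\<in>D. exp (- J e))"
    by (subst prod.reindex) (auto simp: open_prob_def)
  also have "\<dots> = exp (- (\<Sum>e\<in>D. J e))"
    using assms(2) by (simp add: exp_sum sum_negf[symmetric] del: sum_negf)
  finally show ?thesis .
qed

text \<open>Conditionally on the configuration inside the \<open>m\<close>-blocks, a lost cluster is, up to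
  vertices that are already missing, one of boundedly many unions of large \<open>m\<close>-clusters,
  and all edges leaving it at levels above \<open>m\<close> are closed.\<close>
lemma Pr_loss_le:
  fixes g \<delta> \<epsilon> :: real
  assumes z: "z \<in> V" and km: "k < m" and mk: "m + k \<le> n" and g: "0 \<le> g"
    and J: "\<And>x y l. x \<in> V \<Longrightarrow> y \<in> blk l x \<Longrightarrow> y \<notin> blk m x \<Longrightarrow> g * b / real b ^ (2 * l) \<le> J {x, y}"
    and k: "1 / real b ^ k \<le> \<epsilon>"
    and eta: "\<delta> * real b ^ Suc n + real b ^ m \<le> \<epsilon> * real b ^ (n - k)"
  shows "Pr (\<lambda>\<omega>. loss k n \<omega> z) \<le>
    2 ^ (b ^ (Suc n - m + k)) * exp (- ((1 - 3 * \<epsilon>) * g)) +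
    Pr (\<lambda>\<omega>. \<delta> * real b ^ Suc n < real (missing k m (Suc n) \<omega> z))"
proof -
  let ?B = "blk (Suc n) z"
  let ?K = "\<Union>x\<in>?B. coords (blk m x)"
  let ?E = "\<lambda>\<omega>. real (missing k m (Suc n) \<omega> z) \<le> \<delta> * real b ^ Suc n"
  let ?F = "bigs k m ?B"
  let ?U = "unions k m ?B"
  let ?c = "exp (- ((1 - 3 * \<epsilon>) * g))"
  have mn: "m \<le> Suc n" "m \<le> n" "k \<le> m" using km mk by auto
  have V: "x \<in> V" if "x \<in> ?B" for x using that blk_subset by blast
  have finB: "finite ?B" using z by simp
  have K: "finite ?K" "?K \<subseteq> hindex L d"
    using inner_coords[OF z mn(1)] finite_coords[OF finB] coords_subset_hindex[OF blk_subset]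
    by (blast intro: finite_subset)+
  have detE: "determined ?K ?E"
    by (rule determined_comp[OF determined_missing[OF mn(1)], where f="\<lambda>c. real c \<le> \<delta> * real b ^ Suc n"])
  have "Pr (\<lambda>\<omega>. ?E \<omega> \<and> loss k n \<omega> z) \<le> (2 ^ (b ^ (Suc n - m + k)) * ?c) * Pr ?E"
  proof (rule Pr_conditional_bound[OF detE K event_loss[OF z]])
    fix f assume f: "?E f"
    let ?\<U> = "{A \<in> ?U f. (1 - \<epsilon>) * real b ^ (n - k) \<le> card A \<and> card A \<le> b ^ (Suc n - k)}"
    \<comment> \<open>Edges from \<open>A\<close> to the remaining big vertices. Those within an
      \<open>m\<close>-block are left out because \<open>f\<close> has already fixed them; the
      others are independent of \<open>f\<close>.\<close>
    define D where "D A = (\<lambda>(x, y). {x, y}) ` (SIGMA x:A. ?F f - A - blk m x)" for A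
    have FB: "?F f \<subseteq> ?B" by (auto simp: bigs_def)
    have AF: "A \<subseteq> ?F f" if "A \<in> ?\<U>" for A using that by (auto simp: unions_def)
    have D: "D A \<subseteq> hedges L d" "finite (D A)" "?K \<inter> Inr ` D A = {}"
      "(\<Sum>e\<in>D A. J e) = (\<Sum>x\<in>A. \<Sum>y\<in>?F f - A - blk m x. J {x, y})" if "A \<in> ?\<U>" for A
    proof -
      have sub: "A \<subseteq> ?B" using AF[OF that] FB by blast
      have finA: "finite A" "finite (?F f)" using sub FB finB finite_subset by auto
      show "D A \<subseteq> hedges L d"
      proof
        fix e assume "e \<in> D A"
        then obtain x y where e: "e = {x, y}" "x \<in> A" "y \<in> ?F f - A" by (auto simp: D_def)
        then have "x \<in> V" "y \<in> V" "x \<noteq> y" using sub FB V by blast+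
        then show "e \<in> hedges L d" unfolding hedges_def e(1) by blast
      qed
      show "finite (D A)" using finA by (simp add: D_def)
      show "?K \<inter> Inr ` D A = {}"
      proof -
        have False if i: "i \<in> coords (blk m u)" and j: "i = Inr {x, y}" and xy: "x \<in> ?B" "y \<notin> blk m x" for i u x y
          using i
        proof (cases rule: coordsE)
          case (2 v w)
          then have "{v, w} = {x, y}" using j by simp
          then have "x \<in> {v, w}" "y \<in> {v, w}" by simp_all
          then have "x \<in> blk m u" "y \<in> blk m u" using 2 by auto
          then show False using xy(2) blk_eq by blast
        qed (use j in simp)
        then have "i \<notin> Inr ` D A" if "i \<in> coords (blk m u)" for i u
          using sub that unfolding D_def by fast
        then show ?thesis by blast
      qed
      \<comment> \<open>One end lies in \<open>A\<close> and the other outside, so no edge arises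
        from two pairs and the sum over edges becomes a double sum over vertices.\<close>
      have "inj_on (\<lambda>(x, y). {x, y}) (SIGMA x:A. ?F f - A - blk m x)"
        by (auto simp: inj_on_def doubleton_eq_iff)
      then have "(\<Sum>e\<in>D A. J e) = (\<Sum>(x, y)\<in>(SIGMA x:A. ?F f - A - blk m x). J {x, y})"
        unfolding D_def by (subst sum.reindex) (auto simp: case_prod_unfold)
      also have "\<dots> = (\<Sum>x\<in>A. \<Sum>y\<in>?F f - A - blk m x. J {x, y})"
        using finA by (subst sum.Sigma) auto
      finally show "(\<Sum>e\<in>D A. J e) = (\<Sum>x\<in>A. \<Sum>y\<in>?F f - A - blk m x. J {x, y})" .
    qed
    have hD: "Inr ` D A \<subseteq> hindex L d" "finite (Inr ` D A)" if "A \<in> ?\<U>" for A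
      using D[OF that] by (auto simp: hindex_def)
    have fin: "finite ?\<U>" and card: "card ?\<U> \<le> 2 ^ (b ^ (Suc n - m + k))"
    proof -
      have "finite (?U f)" by (rule card_unions(1)[OF z mn(1,3)])
      then show "finite ?\<U>" "card ?\<U> \<le> 2 ^ (b ^ (Suc n - m + k))"
        using card_unions(2)[OF z mn(1,3), of f] card_mono[of "?U f" ?\<U>] by auto
    qed
    have cap: "real (card (?B - ?F f)) \<le> \<delta> * real b ^ Suc n"
    proof -
      have "?B - ?F f = {x \<in> ?B. \<not> big k m f x}" by (auto simp: bigs_def)
      then show ?thesis using f by (simp add: missing_def)
    qed
    have cut: "(1 - 3 * \<epsilon>) * g \<le> (\<Sum>x\<in>A. \<Sum>y\<in>?F f - A - blk m x. J {x, y})" if "A \<in> ?\<U>" for A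
      using that by (intro cut_lower_bound[where J=J, OF z mk g J AF[OF that] FB k]) (use eta cap in auto)
    \<comment> \<open>Inside the \<open>m\<close>-blocks \<open>\<omega>\<close> agrees with
      \<open>f\<close>, so both have the same big vertices and the same candidates. The candidate
      cut out by the lost cluster therefore belongs to a finite family that depends on
      \<open>f\<close> alone.\<close>
    have sep: "\<exists>A\<in>?\<U>. cyl ?K f \<omega> \<and> cyl (Inr ` D A) (\<lambda>_. False) \<omega>"
      if \<omega>: "cyl ?K f \<omega>" "loss k n \<omega> z" for \<omega>
    proof -
      have bigeq: "big k m \<omega> x = big k m f x" and inneq: "inner_cl m \<omega> x = inner_cl m f x" if "x \<in> ?B" for x
      proof -
        have *: "\<omega> i = f i" if "i \<in> coords (blk m x)" for i
          using \<omega>(1) that \<open>x \<in> ?B\<close> by (auto simp: cyl_def)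
        show "inner_cl m \<omega> x = inner_cl m f x"
          unfolding inner_cl_def by (rule determinedD[OF determined_cl[OF blk_subset] *])
        then show "big k m \<omega> x = big k m f x"
          by (simp add: big_def inner_cl_def)
      qed
      have F: "?F \<omega> = ?F f" using bigeq by (auto simp: bigs_def)
      have U: "?U \<omega> = ?U f"
        unfolding unions_def F
      proof (intro Collect_cong conj_cong refl ball_cong)
        fix A x assume "A \<subseteq> ?F f" "x \<in> A"
        then have "x \<in> ?B" using FB by blast
        then show "inner_cl m \<omega> x \<subseteq> A \<longleftrightarrow> inner_cl m f x \<subseteq> A" using inneq by simp
      qed
      obtain A where A: "A \<in> ?U \<omega>" "b ^ (n - k) \<le> card A + card (?B - ?F \<omega>)"
          "card A \<le> b ^ (Suc n - k)"
          "\<And>x y. x \<in> A \<Longrightarrow> y \<in> ?F \<omega> - A \<Longrightarrow> \<not> \<omega> (Inr {x, y})"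
        using loss_separates[OF z km mn(2) \<omega>(2)] by blast
      have "real (b ^ (n - k)) \<le> real (card A + card (?B - ?F \<omega>))"
        using A(2) unfolding of_nat_le_iff .
      then have "real b ^ (n - k) \<le> card A + card (?B - ?F f)"
        unfolding F of_nat_add of_nat_power .
      moreover have "0 \<le> real b ^ m" by simp
      \<comment> \<open>The lost cluster exceeds \<open>A\<close> by at most the missing vertices,
        and \<open>eta\<close> bounds their number by \<open>\<epsilon> * b^(n-k)\<close>.\<close>
      ultimately have "(1 - \<epsilon>) * real b ^ (n - k) \<le> card A"
        using cap eta unfolding left_diff_distrib mult_1 by linarith
      then have "A \<in> ?\<U>" using A(1,3) U by simp
      moreover have "cyl (Inr ` D A) (\<lambda>_. False) \<omega>"
        using A(4) unfolding cyl_def D_def F by auto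
      ultimately show ?thesis using \<omega>(1) by blast
    qed
    have ev: "event (\<lambda>\<omega>. cyl ?K f \<omega> \<and> cyl (Inr ` D A) (\<lambda>_. False) \<omega>)" if "A \<in> ?\<U>" for A
      by (intro event_conj Pr_cyl(1) K hD that)
    have "Pr (\<lambda>\<omega>. cyl ?K f \<omega> \<and> loss k n \<omega> z) \<le>
        Pr (\<lambda>\<omega>. \<exists>A\<in>?\<U>. cyl ?K f \<omega> \<and> cyl (Inr ` D A) (\<lambda>_. False) \<omega>)"
      by (rule Pr_mono[OF event_bex[OF fin ev]]) (use sep in blast)+
    also have "\<dots> \<le> (\<Sum>A\<in>?\<U>. Pr (\<lambda>\<omega>. cyl ?K f \<omega> \<and> cyl (Inr ` D A) (\<lambda>_. False) \<omega>))"
      by (rule Pr_bex_le[OF fin ev])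
    also have "\<dots> \<le> (\<Sum>A\<in>?\<U>. Pr (cyl ?K f) * ?c)"
    proof (rule sum_mono)
      fix A assume A: "A \<in> ?\<U>"
      have "Pr (\<lambda>\<omega>. cyl ?K f \<omega> \<and> cyl (Inr ` D A) (\<lambda>_. False) \<omega>) =
          Pr (cyl ?K f) * exp (- (\<Sum>e\<in>D A. J e))"
        using Pr_cyl_conj_cyl[OF K hD(2)[OF A] hD(1)[OF A] D(3)[OF A]] Pr_edges_closed[OF D(1,2)[OF A]]
        by simp
      also have "\<dots> \<le> Pr (cyl ?K f) * ?c"
        using cut[OF A] unfolding D(4)[OF A] by (intro mult_left_mono Pr_nonneg) simp
      finally show "Pr (\<lambda>\<omega>. cyl ?K f \<omega> \<and> cyl (Inr ` D A) (\<lambda>_. False) \<omega>) \<le> Pr (cyl ?K f) * ?c" .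
    qed
    also have "\<dots> = card ?\<U> * (Pr (cyl ?K f) * ?c)" by simp
    also have "\<dots> \<le> 2 ^ (b ^ (Suc n - m + k)) * (Pr (cyl ?K f) * ?c)"
    proof (rule mult_right_mono)
      have "real (card ?\<U>) \<le> real (2 ^ (b ^ (Suc n - m + k)))"
        using card unfolding of_nat_le_iff .
      then show "real (card ?\<U>) \<le> 2 ^ (b ^ (Suc n - m + k))" by simp
    qed (simp add: Pr_nonneg)
    finally show "Pr (\<lambda>\<omega>. cyl ?K f \<omega> \<and> loss k n \<omega> z) \<le> (2 ^ (b ^ (Suc n - m + k)) * ?c) * Pr (cyl ?K f)"
      by (simp add: mult_ac)
  qed simp
  also have "\<dots> \<le> 2 ^ (b ^ (Suc n - m + k)) * ?c"
    using Pr_le_1[of ?E] by (intro mult_left_le) auto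
  finally have main: "Pr (\<lambda>\<omega>. ?E \<omega> \<and> loss k n \<omega> z) \<le> 2 ^ (b ^ (Suc n - m + k)) * ?c" .
  have evE: "event (\<lambda>\<omega>. \<delta> * real b ^ Suc n < real (missing k m (Suc n) \<omega> z))"
    by (rule event_missing[OF z mn(1)])
  have evE': "event (\<lambda>\<omega>. ?E \<omega> \<and> loss k n \<omega> z)"
    by (rule event_conj[OF event_missing[OF z mn(1)] event_loss[OF z]])
  have "Pr (\<lambda>\<omega>. loss k n \<omega> z) \<le>
      Pr (\<lambda>\<omega>. (?E \<omega> \<and> loss k n \<omega> z) \<or> \<delta> * real b ^ Suc n < real (missing k m (Suc n) \<omega> z))"
    by (rule Pr_mono[OF event_disj[OF evE' evE]]) linarith
  also have "\<dots> \<le> Pr (\<lambda>\<omega>. ?E \<omega> \<and> loss k n \<omega> z) + Pr (\<lambda>\<omega>. \<delta> * real b ^ Suc n < real (missing k m (Suc n) \<omega> z))"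
    by (rule Pr_disj_le[OF evE' evE])
  finally show ?thesis using main by linarith
qed

end

section \<open>The renormalization recursion\<close>

context percolation
begin

lemma finite_coords_blk: "x \<in> V \<Longrightarrow> finite (coords (blk n x))"
  by (intro finite_coords finite_blk)

lemma coords_blk_subset: "coords (blk n x) \<subseteq> hindex L d"
  by (intro coords_subset_hindex blk_subset)

lemma missing_eq_sum_subblocks:
  assumes z: "z \<in> V" and "m \<le> n"
  shows "missing k m n \<omega> z = (\<Sum>B\<in>blk m ` blk n z. card {x \<in> B. \<not> big k m \<omega> x})"
proof -
  let ?S = "blk m ` blk n z"
  have V: "x \<in> V" if "x \<in> blk n z" for x using that blk_subset by blast
  have "{x \<in> blk n z. \<not> big k m \<omega> x} = (\<Union>B\<in>?S. {x \<in> B. \<not> big k m \<omega> x})"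
  proof (intro equalityI subsetI)
    fix x assume "x \<in> {x \<in> blk n z. \<not> big k m \<omega> x}"
    then show "x \<in> (\<Union>B\<in>?S. {x \<in> B. \<not> big k m \<omega> x})" using blk_refl[OF V] by auto
  next
    fix x assume "x \<in> (\<Union>B\<in>?S. {x \<in> B. \<not> big k m \<omega> x})"
    then show "x \<in> {x \<in> blk n z. \<not> big k m \<omega> x}" using blk_nested[OF assms(2)] by auto
  qed
  moreover have "card (\<Union>B\<in>?S. {x \<in> B. \<not> big k m \<omega> x}) = (\<Sum>B\<in>?S. card {x \<in> B. \<not> big k m \<omega> x})"
  proof (rule card_UN_disjoint)
    show "finite ?S" using z by simp
    show "\<forall>B\<in>?S. finite {x \<in> B. \<not> big k m \<omega> x}" using V by auto
    show "\<forall>B\<in>?S. \<forall>B'\<in>?S. B \<noteq> B' \<longrightarrow> {x \<in> B. \<not> big k m \<omega> x} \<inter> {x \<in> B'. \<not> big k m \<omega> x} = {}"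
      using blk_disjoint by blast
  qed
  ultimately show ?thesis by (simp add: missing_def)
qed

text \<open>A single bad subblock has volume at most half of the allowed deficit, so an excessive
  deficit needs two of them. Squaring the probability makes the recursion contract.\<close>
lemma Pr_missing_le_square:
  fixes \<delta> p :: real
  assumes z: "z \<in> V" and mn: "m \<le> n" and \<delta>: "1 / real b ^ (n - m) \<le> \<delta> / 2"
    and p: "\<And>x. x \<in> V \<Longrightarrow> Pr (\<lambda>\<omega>. \<delta> / 2 * real b ^ m < real (missing k m m \<omega> x)) \<le> p"
  shows "Pr (\<lambda>\<omega>. \<delta> * real b ^ n < real (missing k m n \<omega> z)) \<le> real b ^ (2 * (n - m)) * p\<^sup>2"
proof -
  let ?S = "blk m ` blk n z"
  let ?P = "{(B, B'). B \<in> ?S \<and> B' \<in> ?S \<and> B \<noteq> B'}"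
  let ?c = "\<lambda>\<omega> B. real (card {x \<in> B. \<not> big k m \<omega> x})"
  let ?bad = "\<lambda>\<omega> B. \<delta> / 2 * real b ^ m < ?c \<omega> B"
  have V: "x \<in> V" if "x \<in> blk n z" for x using that blk_subset by blast
  have finS: "finite ?S" using z by simp
  have cardS: "card ?S = b ^ (n - m)" by (rule card_subblocks[OF z mn])
  have PS: "?P \<subseteq> ?S \<times> ?S" by auto
  have finP: "finite ?P" by (rule finite_subset[OF PS]) (simp add: finS)
  have bpos: "0 < real b" using b_ge_2 by linarith
  have bn: "real b ^ n = real b ^ m * real b ^ (n - m)"
    using mn by (simp flip: power_add)
  have p0: "0 \<le> p" using p[OF z] Pr_nonneg order_trans by blast
  have two_bad: "\<exists>(B, B')\<in>?P. ?bad \<omega> B \<and> ?bad \<omega> B'" if big: "\<delta> * real b ^ n < real (missing k m n \<omega> z)" for \<omega>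
  proof (rule ccontr)
    assume "\<not> ?thesis"
    then have uniq: "B = B'" if "B \<in> ?S" "B' \<in> ?S" "?bad \<omega> B" "?bad \<omega> B'" for B B'
      using that by blast
    \<comment> \<open>If no subblock is bad, \<open>B0\<close> is arbitrary; the extra term attached
      to it is nonnegative, so the bound below still holds.\<close>
    define B0 where "B0 = (SOME B. B \<in> ?S \<and> ?bad \<omega> B)"
    have "?c \<omega> B \<le> \<delta> / 2 * real b ^ m + (if B = B0 then real b ^ m else 0)" if B: "B \<in> ?S" for B
    proof (cases "?bad \<omega> B")
      case True
      have "B0 \<in> ?S \<and> ?bad \<omega> B0"
        unfolding B0_def by (rule someI[of "\<lambda>B. B \<in> ?S \<and> ?bad \<omega> B", OF conjI[OF B True]])
      then have "B = B0" by (intro uniq[OF B _ True]) auto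
      obtain x where "x \<in> V" "B = blk m x" using B V by auto
      then have "finite B" "card B = b ^ m" by (simp_all add: card_blk)
      then have "card {x \<in> B. \<not> big k m \<omega> x} \<le> b ^ m" using card_mono[of B "{x \<in> B. \<not> big k m \<omega> x}"] by auto
      then have "?c \<omega> B \<le> real (b ^ m)" unfolding of_nat_le_iff .
      moreover have "0 \<le> \<delta> / 2 * real b ^ m"
      proof -
        have "0 \<le> 1 / real b ^ (n - m)" by simp
        then have "0 \<le> \<delta> / 2" using \<delta> by (rule order_trans)
        then show ?thesis by simp
      qed
      ultimately show ?thesis using \<open>B = B0\<close> by simp
    next
      case False
      then have "?c \<omega> B \<le> \<delta> / 2 * real b ^ m" by (simp only: not_less)
      moreover have "0 \<le> real b ^ m" by simp
      ultimately show ?thesis by (auto split: if_split intro: add_increasing2)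
    qed
    then have "(\<Sum>B\<in>?S. ?c \<omega> B) \<le> (\<Sum>B\<in>?S. \<delta> / 2 * real b ^ m + (if B = B0 then real b ^ m else 0))"
      by (rule sum_mono)
    also have "\<dots> \<le> real (card ?S) * (\<delta> / 2 * real b ^ m) + real b ^ m"
      using finS by (simp add: sum.distrib)
    also have "\<dots> \<le> \<delta> / 2 * real b ^ n + \<delta> / 2 * real b ^ n"
    proof (rule add_mono)
      show "real (card ?S) * (\<delta> / 2 * real b ^ m) \<le> \<delta> / 2 * real b ^ n"
        unfolding cardS bn by simp
      have "1 \<le> \<delta> / 2 * real b ^ (n - m)"
        using \<delta> bpos by (simp add: divide_simps split: if_splits)
      then have "real b ^ m * 1 \<le> real b ^ m * (\<delta> / 2 * real b ^ (n - m))"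
        by (rule mult_left_mono) simp
      then show "real b ^ m \<le> \<delta> / 2 * real b ^ n" unfolding bn by (simp add: mult_ac)
    qed
    finally have "real (missing k m n \<omega> z) \<le> \<delta> * real b ^ n"
      unfolding missing_eq_sum_subblocks[OF z mn] by simp
    then show False using big by simp
  qed
  have det: "determined (coords B) (\<lambda>\<omega>. ?bad \<omega> B)" and finc: "finite (coords B)"
    and sub: "coords B \<subseteq> hindex L d" and pB: "Pr (\<lambda>\<omega>. ?bad \<omega> B) \<le> p" if "B \<in> ?S" for B
  proof -
    obtain x where x: "x \<in> V" and B: "B = blk m x" using \<open>B \<in> ?S\<close> V by auto
    show "determined (coords B) (\<lambda>\<omega>. ?bad \<omega> B)"
      unfolding B
      using determined_comp[OF determined_missing_block[OF x order_refl], of m "\<lambda>c. \<delta> / 2 * real b ^ m < real c" k]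
      by (simp add: missing_def)
    show "finite (coords B)" unfolding B by (rule finite_coords_blk[OF x])
    show "coords B \<subseteq> hindex L d" unfolding B by (rule coords_blk_subset)
    show "Pr (\<lambda>\<omega>. ?bad \<omega> B) \<le> p" using p[OF x] unfolding B missing_def .
  qed
  have ev: "event (\<lambda>\<omega>. ?bad \<omega> B)" if "B \<in> ?S" for B
    by (rule event_determined[OF det[OF that] finc[OF that] sub[OF that]])
  have ev2: "event (\<lambda>\<omega>. ?bad \<omega> (fst BB) \<and> ?bad \<omega> (snd BB))" if "BB \<in> ?P" for BB
    using that by (intro event_conj ev) auto
  have "Pr (\<lambda>\<omega>. \<delta> * real b ^ n < real (missing k m n \<omega> z)) \<le>
      Pr (\<lambda>\<omega>. \<exists>BB\<in>?P. ?bad \<omega> (fst BB) \<and> ?bad \<omega> (snd BB))"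
    by (rule Pr_mono[OF event_bex[OF finP ev2]]) (use two_bad in force)+
  also have "\<dots> \<le> (\<Sum>BB\<in>?P. Pr (\<lambda>\<omega>. ?bad \<omega> (fst BB) \<and> ?bad \<omega> (snd BB)))"
    by (rule Pr_bex_le[OF finP ev2])
  also have "\<dots> \<le> (\<Sum>BB\<in>?P. p\<^sup>2)"
  proof (rule sum_mono)
    fix BB assume "BB \<in> ?P"
    then obtain B B' where BB: "BB = (B, B')" "B \<in> ?S" "B' \<in> ?S" "B \<noteq> B'" by auto
    have "coords B \<inter> coords B' = {}"
      using BB blk_disjoint by (intro coords_disjoint) auto
    then have "Pr (\<lambda>\<omega>. ?bad \<omega> B \<and> ?bad \<omega> B') \<le> Pr (\<lambda>\<omega>. ?bad \<omega> B) * Pr (\<lambda>\<omega>. ?bad \<omega> B')"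
      by (rule Pr_independent_le[OF det[OF BB(2)] finc[OF BB(2)] sub[OF BB(2)]
            det[OF BB(3)] finc[OF BB(3)] sub[OF BB(3)]])
    also have "\<dots> \<le> p * p"
      by (intro mult_mono pB[OF BB(2)] pB[OF BB(3)] p0 Pr_nonneg)
    finally show "Pr (\<lambda>\<omega>. ?bad \<omega> (fst BB) \<and> ?bad \<omega> (snd BB)) \<le> p\<^sup>2"
      by (simp add: BB power2_eq_square)
  qed
  also have "\<dots> = card ?P * p\<^sup>2" by simp
  also have "\<dots> \<le> real b ^ (2 * (n - m)) * p\<^sup>2"
  proof (rule mult_right_mono)
    have "card ?P \<le> card (?S \<times> ?S)" using PS finS by (intro card_mono) auto
    also have "\<dots> = b ^ (2 * (n - m))" by (simp add: card_cartesian_product cardS mult_2 power_add)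
    finally have "real (card ?P) \<le> real (b ^ (2 * (n - m)))" unfolding of_nat_le_iff .
    then show "real (card ?P) \<le> real b ^ (2 * (n - m))" by simp
  qed simp
  finally show ?thesis .
qed

text \<open>Union bound along the chain of levels: by \<open>big_chain\<close>, a vertex that is big
  at level \<open>m\<close> and meets no loss before level \<open>n\<close> is still big at
  \<open>n\<close>.\<close>

lemma Pr_not_big_le:
  fixes lam :: "nat \<Rightarrow> real"
  assumes x: "x \<in> V" and "m \<le> n"
    and lam: "\<And>l. m \<le> l \<Longrightarrow> l < n \<Longrightarrow> Pr (\<lambda>\<omega>. loss k l \<omega> x) \<le> lam l"
  shows "Pr (\<lambda>\<omega>. \<not> big k n \<omega> x) \<le> Pr (\<lambda>\<omega>. \<not> big k m \<omega> x) + (\<Sum>l\<in>{m..<n}. lam l)"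
proof -
  have ev: "event (\<lambda>\<omega>. \<not> big k m \<omega> x)" "event (\<lambda>\<omega>. \<exists>l\<in>{m..<n}. loss k l \<omega> x)"
    using x by (auto intro: event_not event_big event_bex event_loss)
  have "Pr (\<lambda>\<omega>. \<not> big k n \<omega> x) \<le> Pr (\<lambda>\<omega>. \<not> big k m \<omega> x \<or> (\<exists>l\<in>{m..<n}. loss k l \<omega> x))"
  proof (rule Pr_mono[OF event_disj[OF ev]])
    show "\<not> big k m \<omega> x \<or> (\<exists>l\<in>{m..<n}. loss k l \<omega> x)" if "\<not> big k n \<omega> x" for \<omega>
      using big_chain[OF x _ \<open>m \<le> n\<close>, of k \<omega>] that by (meson atLeastLessThan_iff)
  qed
  also have "\<dots> \<le> Pr (\<lambda>\<omega>. \<not> big k m \<omega> x) + Pr (\<lambda>\<omega>. \<exists>l\<in>{m..<n}. loss k l \<omega> x)"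
    by (intro Pr_disj_le ev)
  also have "Pr (\<lambda>\<omega>. \<exists>l\<in>{m..<n}. loss k l \<omega> x) \<le> (\<Sum>l\<in>{m..<n}. Pr (\<lambda>\<omega>. loss k l \<omega> x))"
    using x by (intro Pr_bex_le event_loss) auto
  also have "\<dots> \<le> (\<Sum>l\<in>{m..<n}. lam l)"
    using lam by (intro sum_mono) auto
  finally show ?thesis by simp
qed

text \<open>The deficit \<open>\<delta>/2\<close> is split evenly. Failures of \<open>big\<close> at
  level \<open>m\<close> are independent across the \<open>b^(n-m)\<close> subblocks, so Chebyshev's
  inequality controls their number; vertices hit by a loss at levels \<open>m\<close> to
  \<open>n - 1\<close> are controlled in expectation by Markov's inequality.\<close>

lemma Pr_missing_block_le:
  fixes lam :: "nat \<Rightarrow> real" and \<delta> :: real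
  assumes z: "z \<in> V" and mn: "m \<le> n" and \<delta>: "0 < \<delta>"
    and big: "\<And>x. x \<in> V \<Longrightarrow> Pr (\<lambda>\<omega>. \<not> big k m \<omega> x) \<le> \<delta> / 8"
    and lam: "\<And>x l. x \<in> V \<Longrightarrow> m \<le> l \<Longrightarrow> l < n \<Longrightarrow> Pr (\<lambda>\<omega>. loss k l \<omega> x) \<le> lam l"
  shows "Pr (\<lambda>\<omega>. \<delta> / 2 * real b ^ n < real (missing k n n \<omega> z)) \<le>
    64 / (\<delta>\<^sup>2 * real b ^ (n - m)) + 4 / \<delta> * (\<Sum>l\<in>{m..<n}. lam l)"
proof -
  let ?X = "blk n z"
  let ?c = "\<delta> / 4 * real b ^ n"
  let ?A = "\<lambda>\<omega>. ?c \<le> real (card {x \<in> ?X. \<not> big k m \<omega> x})"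
  let ?L = "\<lambda>\<omega> x. \<exists>l\<in>{m..<n}. loss k l \<omega> x"
  let ?D = "\<lambda>\<omega>. ?c \<le> real (card {x \<in> ?X. ?L \<omega> x})"
  have bpos: "0 < real b" using b_ge_2 by linarith
  have V: "x \<in> V" if "x \<in> ?X" for x using that blk_subset by blast
  have finX: "finite ?X" and cX: "real (card ?X) = real b ^ n" using z by (simp_all add: card_blk)
  have bn: "real b ^ n = real b ^ m * real b ^ (n - m)"
    using mn by (simp flip: power_add)
  have evL: "event (\<lambda>\<omega>. ?L \<omega> x)" if "x \<in> ?X" for x
    using V[OF that] by (intro event_bex event_loss) auto
  have detL: "determined (coords ?X) (\<lambda>\<omega>. ?L \<omega> x)" if "x \<in> ?X" for x
  proof (rule determined_bex)
    fix l assume "l \<in> {m..<n}"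
    then show "determined (coords ?X) (\<lambda>\<omega>. loss k l \<omega> x)"
      using that by (intro determined_mono[OF determined_loss] coords_mono blk_nested) auto
  qed
  have evA: "event ?A"
    using event_missing[OF z mn, of "\<lambda>c. ?c \<le> real c" k] by (simp add: missing_def)
  have evD: "event ?D"
    using event_block[OF z determined_comp[OF determined_card[OF detL], where f="\<lambda>c. ?c \<le> real c"]] .
  have "Pr (\<lambda>\<omega>. \<delta> / 2 * real b ^ n < real (missing k n n \<omega> z)) \<le> Pr (\<lambda>\<omega>. ?A \<omega> \<or> ?D \<omega>)"
  proof (rule Pr_mono[OF event_disj[OF evA evD]])
    fix \<omega> assume *: "\<delta> / 2 * real b ^ n < real (missing k n n \<omega> z)"
    have "{x \<in> ?X. \<not> big k n \<omega> x} \<subseteq> {x \<in> ?X. \<not> big k m \<omega> x} \<union> {x \<in> ?X. ?L \<omega> x}"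
    proof
      fix x assume x: "x \<in> {x \<in> ?X. \<not> big k n \<omega> x}"
      then show "x \<in> {x \<in> ?X. \<not> big k m \<omega> x} \<union> {x \<in> ?X. ?L \<omega> x}"
        using big_chain[OF V _ mn, of x k \<omega>] by (cases "?L \<omega> x") auto
    qed
    then have "missing k n n \<omega> z \<le> card ({x \<in> ?X. \<not> big k m \<omega> x} \<union> {x \<in> ?X. ?L \<omega> x})"
      unfolding missing_def using finX by (intro card_mono) auto
    also have "\<dots> \<le> card {x \<in> ?X. \<not> big k m \<omega> x} + card {x \<in> ?X. ?L \<omega> x}"
      by (rule card_Un_le)
    finally have "real (missing k n n \<omega> z) \<le>
        real (card {x \<in> ?X. \<not> big k m \<omega> x}) + real (card {x \<in> ?X. ?L \<omega> x})"
      by linarith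
    then show "?A \<omega> \<or> ?D \<omega>" using * by linarith
  qed
  also have "\<dots> \<le> Pr ?A + Pr ?D" by (rule Pr_disj_le[OF evA evD])
  also have "Pr ?A \<le> 64 / (\<delta>\<^sup>2 * real b ^ (n - m))"
  proof -
    \<comment> \<open>Density \<open>\<delta>/8\<close> and neighbourhoods of size
      \<open>b^m\<close> give \<open>b^m / ((\<delta>/8)^2 * b^n)\<close>, which is
      \<open>64 / (\<delta>^2 * b^(n-m))\<close>.\<close>
    have "Pr (\<lambda>\<omega>. 2 * (\<delta> / 8) * card ?X \<le> real (card {x \<in> ?X. \<not> big k m \<omega> x}))
        \<le> real (b ^ m) / ((\<delta> / 8)\<^sup>2 * card ?X)"
    proof (rule Pr_count_Chebyshev[where N="blk m"])
      show "event (\<lambda>\<omega>. \<not> big k m \<omega> x)" if "x \<in> ?X" for x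
        using V[OF that] by (intro event_not event_big)
      show "card (?X \<inter> blk m x) \<le> b ^ m" if "x \<in> ?X" for x
        using card_mono[of "blk m x" "?X \<inter> blk m x"] V[OF that] card_blk[of x m] by auto
      fix x y assume xy: "x \<in> ?X" "y \<in> ?X" "y \<notin> blk m x"
      have "blk m x \<noteq> blk m y" using xy(3) blk_refl[OF V[OF xy(2)], of m] by auto
      then have "coords (blk m x) \<inter> coords (blk m y) = {}"
        by (intro coords_disjoint blk_disjoint)
      note disj = this
      have det: "determined (coords (blk m u)) (\<lambda>\<omega>. \<not> big k m \<omega> u)" for u
        by (rule determined_comp[OF determined_big[OF subset_refl]])
      show "Pr (\<lambda>\<omega>. \<not> big k m \<omega> x \<and> \<not> big k m \<omega> y) \<le>
          Pr (\<lambda>\<omega>. \<not> big k m \<omega> x) * Pr (\<lambda>\<omega>. \<not> big k m \<omega> y)"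
        using Pr_independent_le[OF det finite_coords_blk[OF V[OF xy(1)]] coords_blk_subset
            det finite_coords_blk[OF V[OF xy(2)]] coords_blk_subset disj] .
    qed (use finX blk_refl[OF z, of n] \<delta> big V in auto)
    then show ?thesis
      unfolding cX bn using bpos \<delta> by (simp add: power2_eq_square divide_simps mult_ac split: if_splits)
  qed
  also have "Pr ?D \<le> 4 / \<delta> * (\<Sum>l\<in>{m..<n}. lam l)"
  proof -
    have "Pr ?D \<le> (\<Sum>x\<in>?X. Pr (\<lambda>\<omega>. ?L \<omega> x)) / ?c"
      using bpos \<delta> by (intro Pr_count_Markov finX evL) auto
    also have "\<dots> \<le> (\<Sum>x\<in>?X. \<Sum>l\<in>{m..<n}. lam l) / ?c"
    proof (intro divide_right_mono sum_mono)
      fix x assume x: "x \<in> ?X"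
      have "Pr (\<lambda>\<omega>. ?L \<omega> x) \<le> (\<Sum>l\<in>{m..<n}. Pr (\<lambda>\<omega>. loss k l \<omega> x))"
        using V[OF x] by (intro Pr_bex_le event_loss) auto
      also have "\<dots> \<le> (\<Sum>l\<in>{m..<n}. lam l)"
        using lam[OF V[OF x]] by (intro sum_mono) auto
      finally show "Pr (\<lambda>\<omega>. ?L \<omega> x) \<le> (\<Sum>l\<in>{m..<n}. lam l)" .
    qed (use \<delta> in auto)
    also have "\<dots> = 4 / \<delta> * (\<Sum>l\<in>{m..<n}. lam l)"
      using L_ge_2 \<delta> cX by simp
    finally show ?thesis .
  qed
  finally show ?thesis by simp
qed

text \<open>Strong induction on the level, with \<open>lam\<close> as the proposed bound on loss
  probabilities. At level \<open>n\<close> the configuration is revealed inside blocks of level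
  \<open>m = n - H\<close>, and the density of big vertices there is estimated starting from level
  \<open>m - h n\<close>. Assumption \<open>rec\<close> says that \<open>lam\<close> reproduces
  itself, and its small tail sums keep the failure probability of \<open>big\<close> bounded at
  every level.\<close>

lemma Pr_loss_and_Pr_not_big:
  fixes lam g :: "nat \<Rightarrow> real" and h :: "nat \<Rightarrow> nat" and \<delta> \<epsilon> :: real
  assumes \<delta>: "0 < \<delta>" "1 / real b ^ Suc H \<le> \<delta> / 2"
    and base_loss: "\<And>l z. z \<in> V \<Longrightarrow> 1 \<le> l \<Longrightarrow> l < n0 \<Longrightarrow> Pr (\<lambda>\<omega>. loss k l \<omega> z) \<le> lam l"
    and base_big: "\<And>l x. x \<in> V \<Longrightarrow> l \<le> n0 \<Longrightarrow> Pr (\<lambda>\<omega>. \<not> big k l \<omega> x) \<le> \<delta> / 16"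
    and lam_sum: "\<And>N. n0 \<le> N \<Longrightarrow> (\<Sum>l\<in>{n0..<N}. lam l) \<le> \<delta> / 16"
    and k: "1 / real b ^ k \<le> \<epsilon>" and kH: "k \<le> H"
    and eta: "\<And>n. n0 \<le> n \<Longrightarrow> \<delta> * real b ^ Suc n + real b ^ (n - H) \<le> \<epsilon> * real b ^ (n - k)"
    and large: "\<And>n. n0 \<le> n \<Longrightarrow> 1 \<le> n \<and> k < n - H \<and> h n < n - H"
    and g: "\<And>n. n0 \<le> n \<Longrightarrow> 0 \<le> g n"
    and J: "\<And>n x y l. n0 \<le> n \<Longrightarrow> x \<in> V \<Longrightarrow> y \<in> blk l x \<Longrightarrow> y \<notin> blk (n - H) x \<Longrightarrow>
      g n * b / real b ^ (2 * l) \<le> J {x, y}"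
    and rec: "\<And>n. n0 \<le> n \<Longrightarrow>
      2 ^ (b ^ (Suc H + k)) * exp (- ((1 - 3 * \<epsilon>) * g n)) +
      real b ^ (2 * Suc H) *
        (64 / (\<delta>\<^sup>2 * real b ^ h n) + 4 / \<delta> * (\<Sum>l\<in>{n - H - h n..<n - H}. lam l))\<^sup>2 \<le> lam n"
  shows "1 \<le> n \<Longrightarrow> z \<in> V \<Longrightarrow> Pr (\<lambda>\<omega>. loss k n \<omega> z) \<le> lam n"
    and "x \<in> V \<Longrightarrow> Pr (\<lambda>\<omega>. \<not> big k n \<omega> x) \<le> \<delta> / 8"
proof -
  have n0: "1 \<le> n0" using large[of n0] by simp
  \<comment> \<open>Only losses strictly below \<open>n\<close> enter, so this statement can serve
    inside the induction as well as after it.\<close>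
  have big_from_loss: "Pr (\<lambda>\<omega>. \<not> big k n \<omega> x) \<le> \<delta> / 8"
    if "x \<in> V" and loss: "\<And>l. n0 \<le> l \<Longrightarrow> l < n \<Longrightarrow> Pr (\<lambda>\<omega>. loss k l \<omega> x) \<le> lam l" for x n
  proof (cases "n \<le> n0")
    case True
    then have "Pr (\<lambda>\<omega>. \<not> big k n \<omega> x) \<le> \<delta> / 16" using base_big that(1) by blast
    then show ?thesis using \<delta> by simp
  next
    case False
    then have n: "n0 \<le> n" by simp
    have "Pr (\<lambda>\<omega>. \<not> big k n \<omega> x) \<le> Pr (\<lambda>\<omega>. \<not> big k n0 \<omega> x) + (\<Sum>l\<in>{n0..<n}. lam l)"
      by (rule Pr_not_big_le[OF that(1) n loss])
    then show ?thesis using base_big[OF that(1) order_refl] lam_sum[OF n] by simp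
  qed
  have loss: "Pr (\<lambda>\<omega>. loss k n \<omega> z) \<le> lam n" if "1 \<le> n" "z \<in> V" for n z
    using that
  proof (induction n arbitrary: z rule: less_induct)
    case (less n)
    show ?case
    proof (cases "n < n0")
      case True
      then show ?thesis using base_loss less.prems by blast
    next
      case False
      then have n: "n0 \<le> n" by simp
      define m where "m = n - H"
      define m0 where "m0 = m - h n"
      let ?p = "64 / (\<delta>\<^sup>2 * real b ^ h n) + 4 / \<delta> * (\<Sum>l\<in>{m0..<m}. lam l)"
      \<comment> \<open>The bound \<open>1 \<le> m0\<close> keeps every level of the window within
        reach of the induction hypothesis, which excludes level 0.\<close>
      have m: "k < m" "h n < m" "m \<le> n" "m + k \<le> n" "Suc n - m = Suc H" "m - m0 = h n" "m0 \<le> m" "1 \<le> m0"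
        using large[OF n] kH unfolding m0_def m_def by linarith+
      have "Pr (\<lambda>\<omega>. \<delta> / 2 * real b ^ m < real (missing k m m \<omega> x)) \<le> ?p" if "x \<in> V" for x
      proof -
        have "Pr (\<lambda>\<omega>. \<not> big k m0 \<omega> u) \<le> \<delta> / 8" if "u \<in> V" for u
          using m n0 that by (intro big_from_loss less.IH) auto
        moreover have "Pr (\<lambda>\<omega>. loss k l \<omega> u) \<le> lam l" if "u \<in> V" "m0 \<le> l" "l < m" for u l
          using m that by (intro less.IH) auto
        ultimately show ?thesis
          using Pr_missing_block_le[OF \<open>x \<in> V\<close> m(7) \<delta>(1)] m(6) by simp
      qed
      then have "Pr (\<lambda>\<omega>. \<delta> * real b ^ Suc n < real (missing k m (Suc n) \<omega> z)) \<le>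
          real b ^ (2 * (Suc n - m)) * ?p\<^sup>2"
        using \<delta>(2) m by (intro Pr_missing_le_square less.prems) auto
      moreover have "Pr (\<lambda>\<omega>. loss k n \<omega> z) \<le>
        2 ^ (b ^ (Suc n - m + k)) * exp (- ((1 - 3 * \<epsilon>) * g n)) +
        Pr (\<lambda>\<omega>. \<delta> * real b ^ Suc n < real (missing k m (Suc n) \<omega> z))"
        using eta[OF n] J[OF n] unfolding m_def[symmetric]
        by (intro Pr_loss_le[OF less.prems(2) m(1,4) g[OF n] _ k])
      ultimately show ?thesis
        using rec[OF n] unfolding m_def[symmetric] m0_def[symmetric] m(5) by linarith
    qed
  qed
  show "1 \<le> n \<Longrightarrow> z \<in> V \<Longrightarrow> Pr (\<lambda>\<omega>. loss k n \<omega> z) \<le> lam n" by (rule loss)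
  show "x \<in> V \<Longrightarrow> Pr (\<lambda>\<omega>. \<not> big k n \<omega> x) \<le> \<delta> / 8"
    using n0 by (intro big_from_loss loss) auto
qed

end

section \<open>From block clusters to an infinite cluster\<close>

context percolation
begin

section \<open>The initial scale: completely open blocks\<close>

lemma card_coords_blk_le:
  assumes "z \<in> V"
  shows "card (coords (blk n z)) \<le> b ^ n + b ^ n * b ^ n"
proof -
  let ?B = "blk n z"
  let ?E = "{{x, y} | x y. x \<in> ?B \<and> y \<in> ?B \<and> x \<noteq> y}"
  have fin: "finite ?B" and card: "card ?B = b ^ n" using assms by (simp_all add: card_blk)
  have sub: "?E \<subseteq> (\<lambda>(x, y). {x, y}) ` (?B \<times> ?B)" by auto
  have "card ?E \<le> card ((\<lambda>(x, y). {x, y}) ` (?B \<times> ?B))"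
    using fin by (intro card_mono sub) auto
  also have "\<dots> \<le> card (?B \<times> ?B)" using fin by (intro card_image_le) auto
  finally have E: "card ?E \<le> b ^ n * b ^ n" by (simp add: card_cartesian_product card)
  have "card (coords ?B) \<le> card (Inl ` ?B :: (hvert + hvert set) set) + card (Inr ` ?E :: (hvert + hvert set) set)"
    unfolding coords_def by (rule card_Un_le)
  also have "card (Inl ` ?B :: (hvert + hvert set) set) = b ^ n" by (simp add: card_image card)
  also have "card (Inr ` ?E :: (hvert + hvert set) set) = card ?E" by (simp add: card_image)
  finally show ?thesis using E by linarith
qed

lemma Pr_not_full_le:
  fixes c :: real
  assumes z: "z \<in> V" and "0 \<le> c" and q: "1 - q \<le> c"
    and J: "\<And>x y. x \<in> V \<Longrightarrow> y \<in> blk n x \<Longrightarrow> x \<noteq> y \<Longrightarrow> exp (- J {x, y}) \<le> c"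
  shows "Pr (\<lambda>\<omega>. \<not> full n \<omega> z) \<le> (b ^ n + b ^ n * b ^ n) * c"
proof -
  let ?K = "coords (blk n z)"
  have finK: "finite ?K" and KI: "?K \<subseteq> hindex L d"
    by (rule finite_coords_blk[OF z], rule coords_blk_subset)
  have single: "(\<lambda>\<omega>. \<not> \<omega> i) = cyl {i} (\<lambda>_. False)" for i :: "hvert + hvert set"
    by (simp add: cyl_def fun_eq_iff)
  have ev: "event (\<lambda>\<omega>. \<not> \<omega> i)" and Pr: "Pr (\<lambda>\<omega>. \<not> \<omega> i) = 1 - open_prob i" if "i \<in> ?K" for i
    unfolding single using Pr_cyl[of "{i}" "\<lambda>_. False"] that KI by auto
  have "Pr (\<lambda>\<omega>. \<not> full n \<omega> z) = Pr (\<lambda>\<omega>. \<exists>i\<in>?K. \<not> \<omega> i)"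
    by (simp add: full_def)
  also have "\<dots> \<le> (\<Sum>i\<in>?K. Pr (\<lambda>\<omega>. \<not> \<omega> i))" by (rule Pr_bex_le[OF finK ev])
  also have "\<dots> \<le> (\<Sum>i\<in>?K. c)"
  proof (rule sum_mono)
    fix i assume i: "i \<in> ?K"
    show "Pr (\<lambda>\<omega>. \<not> \<omega> i) \<le> c"
      using i
    proof (cases rule: coordsE)
      case (2 x y)
      have "x \<in> V" using 2(2) blk_subset by blast
      moreover have "y \<in> blk n x" using 2(2,3) blk_eq by blast
      ultimately have "exp (- J {x, y}) \<le> c" using J 2(4) by blast
      then show ?thesis unfolding Pr[OF i] by (simp add: 2 open_prob_def)
    qed (use q Pr[OF i] in \<open>simp add: open_prob_def\<close>)
  qed
  also have "\<dots> = card ?K * c" by simp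
  also have "\<dots> \<le> (b ^ n + b ^ n * b ^ n) * c"
  proof (rule mult_right_mono[OF _ \<open>0 \<le> c\<close>])
    show "real (card ?K) \<le> real (b ^ n + b ^ n * b ^ n)"
      using card_coords_blk_le[OF z] unfolding of_nat_le_iff .
  qed
  finally show ?thesis .
qed

text \<open>An open path is finite and hence stays in some block around the origin; the global
  cluster is the increasing union of the block clusters.\<close>

lemma rtrancl_open_edge_rel_iff:
  "(horigin, y) \<in> (open_edge_rel L d \<omega>)\<^sup>* \<longleftrightarrow> (\<exists>n. y \<in> cl (blk n horigin) \<omega> horigin)"
proof
  assume "(horigin, y) \<in> (open_edge_rel L d \<omega>)\<^sup>*"
  then show "\<exists>n. y \<in> cl (blk n horigin) \<omega> horigin"
  proof (induction rule: rtrancl_induct)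
    case base
    show ?case using cl_refl by blast
  next
    case (step y z)
    then obtain n where n: "y \<in> cl (blk n horigin) \<omega> horigin" by blast
    have "y \<in> V" "z \<in> V" using step(2) by (auto simp: open_edge_rel_def hedges_def doubleton_eq_iff)
    then obtain m1 m2 where m: "y \<in> blk m1 horigin" "z \<in> blk m2 horigin"
      using ex_blk[OF horigin_in_V] by blast
    let ?N = "max n (max m1 m2)"
    have "y \<in> cl (blk ?N horigin) \<omega> horigin"
      using cl_mono[OF blk_mono[of n ?N horigin]] n by auto
    moreover have "(y, z) \<in> conn (blk ?N horigin) \<omega>"
    proof -
      have "m1 \<le> ?N" "m2 \<le> ?N" by simp_all
      then have "y \<in> blk ?N horigin" "z \<in> blk ?N horigin"
        using m blk_mono by blast+
      then show ?thesis using step(2) by (simp add: conn_def)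
    qed
    ultimately have "z \<in> cl (blk ?N horigin) \<omega> horigin"
      by (auto simp: cl_def intro: rtrancl_into_rtrancl)
    then show ?case ..
  qed
next
  assume "\<exists>n. y \<in> cl (blk n horigin) \<omega> horigin"
  then show "(horigin, y) \<in> (open_edge_rel L d \<omega>)\<^sup>*"
    using rtrancl_mono[of "conn (blk n horigin) \<omega>" "open_edge_rel L d \<omega>" for n]
    by (auto simp: cl_def conn_def)
qed

text \<open>Blocks are finite and exhaust \<open>V\<close>, so an infinite cluster is one that
  leaves every block. This expresses the event through countably many events on finite coordinate
  sets, which yields measurability and a decreasing limit.\<close>

lemma infinite_cluster0_iff:
  "infinite (cluster0 L d \<omega>) \<longleftrightarrow>
   (\<forall>N. \<omega> (Inl horigin) \<and> (\<exists>n. \<not> cl (blk n horigin) \<omega> horigin \<subseteq> blk N horigin))"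
  (is "_ \<longleftrightarrow> ?R")
proof -
  let ?C = "\<Union>n. cl (blk n horigin) \<omega> horigin"
  have C: "cluster0 L d \<omega> = (if \<omega> (Inl horigin) then ?C else {})"
    unfolding cluster0_def rtrancl_open_edge_rel_iff by auto
  have CV: "?C \<subseteq> V"
    using cl_subset[OF blk_refl[OF horigin_in_V]] blk_subset by blast
  have "finite ?C \<longleftrightarrow> (\<exists>N. ?C \<subseteq> blk N horigin)"
  proof
    assume fin: "finite ?C"
    have "\<exists>f. \<forall>y\<in>?C. y \<in> blk (f y) horigin"
      using ex_blk[OF horigin_in_V] CV by (intro bchoice) blast
    then obtain f where f: "\<And>y. y \<in> ?C \<Longrightarrow> y \<in> blk (f y) horigin" by blast
    have "y \<in> blk (Max (f ` ?C)) horigin" if "y \<in> ?C" for y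
    proof -
      have "f y \<le> Max (f ` ?C)" using fin that by (intro Max_ge finite_imageI imageI)
      then show ?thesis using blk_mono f[OF that] by blast
    qed
    then show "\<exists>N. ?C \<subseteq> blk N horigin" by blast
  next
    assume "\<exists>N. ?C \<subseteq> blk N horigin"
    then show "finite ?C" using finite_subset[OF _ finite_blk[OF horigin_in_V]] by blast
  qed
  then have "infinite ?C \<longleftrightarrow> (\<forall>N. \<exists>n. \<not> cl (blk n horigin) \<omega> horigin \<subseteq> blk N horigin)"
    by (simp add: UN_subset_iff)
  then show ?thesis unfolding C by simp
qed

text \<open>If the origin is big at level \<open>N + 1 + k\<close>, its cluster has at least
  \<open>b^(N+1)\<close> vertices, more than the \<open>N\<close>-block can hold. Each of the
  decreasing events of leaving the \<open>N\<close>-block thus has probability at least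
  \<open>1 - c\<close>, and so has their intersection.\<close>

lemma Pr_infinite_cluster0:
  assumes "\<And>n. Pr (\<lambda>\<omega>. \<not> big k n \<omega> horigin) \<le> c"
  shows "1 - c \<le> Pr (\<lambda>\<omega>. infinite (cluster0 L d \<omega>))"
proof -
  let ?E = "\<lambda>N \<omega>. \<omega> (Inl horigin) \<and> (\<exists>n. \<not> cl (blk n horigin) \<omega> horigin \<subseteq> blk N horigin)"
  let ?S = "\<lambda>N. {\<omega> \<in> space M. ?E N \<omega>}"
  have "event (\<lambda>\<omega>. \<omega> (Inl horigin))"
    using event_block[OF horigin_in_V, of 0 "\<lambda>\<omega>. \<omega> (Inl horigin)"]
      Inl_coords[OF blk_refl[OF horigin_in_V]] by (simp add: determined_def)
  moreover have "event (\<lambda>\<omega>. \<not> cl (blk n horigin) \<omega> horigin \<subseteq> blk N horigin)" for n N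
    by (rule event_block[OF horigin_in_V
          determined_comp[OF determined_cl[OF blk_subset], where f="\<lambda>C. \<not> C \<subseteq> blk N horigin"]])
  ultimately have ev: "event (?E N)" for N
    unfolding event_def by (intro sets.sets_Collect_conj sets.sets_Collect_countable_Ex)
  have dec: "decseq ?S"
  proof (rule decseq_SucI)
    show "?S (Suc N) \<subseteq> ?S N" for N
      using blk_mono[of N "Suc N" horigin] by auto
  qed
  have "(\<lambda>N. measure M (?S N)) \<longlonglongrightarrow> measure M (\<Inter>N. ?S N)"
    using ev dec by (intro finite_Lim_measure_decseq) (auto simp: event_def)
  moreover have "1 - c \<le> measure M (?S N)" for N
  proof -
    let ?n = "Suc N + k"
    have "1 - c \<le> 1 - Pr (\<lambda>\<omega>. \<not> big k ?n \<omega> horigin)" using assms[of ?n] by simp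
    also have "\<dots> = Pr (\<lambda>\<omega>. big k ?n \<omega> horigin)"
      using Pr_not[OF event_big[OF horigin_in_V, of k ?n]] by simp
    also have "\<dots> \<le> Pr (?E N)"
    proof (rule Pr_mono[OF ev])
      fix \<omega> assume "big k ?n \<omega> horigin"
      then have big: "b ^ Suc N \<le> card (cl (blk ?n horigin) \<omega> horigin)" by (simp add: big_def)
      have "1 < b ^ Suc N" "b ^ N < b ^ Suc N"
        using one_less_power[of b "Suc N"] power_strict_increasing[of N "Suc N" b] b_ge_2 by linarith+
      then have "\<omega> (Inl horigin)" "\<not> cl (blk ?n horigin) \<omega> horigin \<subseteq> blk N horigin"
        using big cl_open[of "blk ?n horigin" \<omega> horigin] finite_blk[OF horigin_in_V, of N]
          card_mono[of "blk N horigin" "cl (blk ?n horigin) \<omega> horigin"] card_blk[OF horigin_in_V, of N]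
        by linarith+
      then show "?E N \<omega>" by blast
    qed
    finally show ?thesis by (simp add: Pr_def)
  qed
  ultimately have "1 - c \<le> measure M (\<Inter>N. ?S N)"
    by (intro LIMSEQ_le_const) auto
  moreover have "(\<Inter>N. ?S N) = {\<omega> \<in> space M. infinite (cluster0 L d \<omega>)}"
    unfolding infinite_cluster0_iff by auto
  ultimately show ?thesis by (simp add: Pr_def)
qed

end

text \<open>After division by \<open>n^(-(1+\<eta>))\<close> every term tends to 0. The critical one
  comes from the window of length \<open>sqrt n\<close>:
  \<open>sqrt n * n^(-1-\<eta>) = n^(-1/2-\<eta>)\<close> is small against
  \<open>n^(-(1+\<eta>)/2)\<close>, so its square is small against
  \<open>n^(-(1+\<eta>))\<close>.\<close>

lemma eventually_recursion:
  fixes C1 C2 C3 C4 \<eta> \<gamma> :: real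
  assumes "0 < \<eta>" "0 < \<gamma>"
  shows "\<forall>\<^sub>F n in at_top. C1 * ((real n - real H + 1) * \<gamma>) powr - (1 + 2 * \<eta>) +
      C2 * (C3 * 2 powr (1 - sqrt (real n)) + C4 * (sqrt (real n) * (real n / 2) powr - (1 + \<eta>)))\<^sup>2
      \<le> real n powr - (1 + \<eta>)"
proof -
  let ?u = "\<lambda>n. ((real n - real H + 1) * \<gamma>) powr - (1 + 2 * \<eta>)"
  let ?v = "\<lambda>n. 2 powr (1 - sqrt (real n))"
  let ?w = "\<lambda>n. sqrt (real n) * (real n / 2) powr - (1 + \<eta>)"
  have u: "(\<lambda>n. ?u n / real n powr - (1 + \<eta>)) \<longlonglongrightarrow> 0"
    using assms by real_asymp
  have v: "(\<lambda>n. ?v n / real n powr (- (1 + \<eta>) / 2)) \<longlonglongrightarrow> 0"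
    using assms by real_asymp
  have w: "(\<lambda>n. ?w n / real n powr (- (1 + \<eta>) / 2)) \<longlonglongrightarrow> 0"
    using assms by real_asymp
  have "(\<lambda>n. C1 * (?u n / real n powr - (1 + \<eta>)) + C2 * (C3 * (?v n / real n powr (- (1 + \<eta>) / 2)) +
      C4 * (?w n / real n powr (- (1 + \<eta>) / 2)))\<^sup>2) \<longlonglongrightarrow> C1 * 0 + C2 * (C3 * 0 + C4 * 0)\<^sup>2"
    by (intro tendsto_intros u v w)
  then have "\<forall>\<^sub>F n in at_top. C1 * (?u n / real n powr - (1 + \<eta>)) + C2 * (C3 * (?v n / real n powr (- (1 + \<eta>) / 2)) +
      C4 * (?w n / real n powr (- (1 + \<eta>) / 2)))\<^sup>2 < 1"
    by (rule order_tendstoD) simp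
  then show ?thesis
    using eventually_gt_at_top[of 0]
  proof eventually_elim
    case (elim n)
    define s where "s = real n powr (- (1 + \<eta>) / 2)"
    have s: "0 < s" "real n powr - (1 + \<eta>) = s\<^sup>2"
      using elim(2) by (simp_all add: s_def power2_eq_square flip: powr_add)
    have "C1 * ?u n + C2 * (C3 * ?v n + C4 * ?w n)\<^sup>2 =
        (C1 * (?u n / s\<^sup>2) + C2 * (C3 * (?v n / s) + C4 * (?w n / s))\<^sup>2) * s\<^sup>2"
      using s(1) by (simp add: field_simps power2_eq_square)
    also have "\<dots> \<le> 1 * s\<^sup>2"
      using elim(1) unfolding s(2) s_def[symmetric] by (intro mult_right_mono) auto
    finally show ?case unfolding s(2) by simp
  qed
qed

section \<open>The double logarithmic kernel\<close>

context hierarchical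
begin

text \<open>With cutoff \<open>L^(n0+1)\<close> the constant part of the kernel covers exactly the
  distances of level at most \<open>n0\<close>, where \<open>N0\<close> dominates the double
  logarithmic expression. Beyond the cutoff the iterated logarithm increases with the level
  \<open>t > m\<close>, and \<open>b^(-2t)\<close> is at least \<open>b^(-2l)\<close>.\<close>

lemma kernelJ_ge:
  fixes a :: real
  assumes "x \<in> V" "y \<in> blk l x" "y \<notin> blk m x" and a: "0 < a"
    and nonneg: "0 \<le> ln (ln (real L ^ Suc m))"
    and N0: "a * b * ln (ln (real L ^ Suc n0)) \<le> real N0"
  shows "a * ln (ln (real L ^ Suc m)) * b / real b ^ (2 * l) \<le> kernelJ L d a N0 (L ^ Suc n0) {x, y}"
proof -
  define t where "t = lev x y"
  have y: "y \<in> V" "x \<noteq> y"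
    using assms(1-3) blk_subset blk_refl by blast+
  have t: "Suc m \<le> t" "t \<le> l"
    using in_blk_iff[OF assms(1) y(1)] assms(2,3) by (simp_all add: t_def not_le Suc_le_eq)
  have hlen: "hlen L {x, y} = real L ^ t"
    unfolding t_def by (rule hlen_eq[OF assms(1) y])
  have b1: "1 \<le> real b" using b_ge_2 by linarith
  have lnln: "ln (ln (real L ^ i)) \<le> ln (ln (real L ^ j))" if "1 \<le> i" "i \<le> j" for i j
  proof -
    have "real L ^ i \<le> real L ^ j" using L_ge_2 that by (intro power_increasing) auto
    moreover have "1 < real L ^ i" using L_ge_2 that by (intro one_less_power) auto
    ultimately have "ln (real L ^ i) \<le> ln (real L ^ j)" "0 < ln (real L ^ i)"
      by (intro ln_mono ln_gt_zero; linarith)+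
    then show ?thesis by (rule ln_mono)
  qed
  show ?thesis
  proof (cases "Suc n0 \<le> t")
    case True
    then have "real (L ^ Suc n0) \<le> real L ^ t"
      using L_ge_2 unfolding of_nat_power by (intro power_increasing) auto
    then have "kernelJ L d a N0 (L ^ Suc n0) {x, y} = a * ln (ln (real L ^ t)) * b / real b ^ (2 * t)"
      unfolding kernelJ_def hlen by (simp add: mult_ac flip: power_mult)
    moreover have "a * ln (ln (real L ^ Suc m)) * b / real b ^ (2 * l) \<le>
        a * ln (ln (real L ^ t)) * b / real b ^ (2 * t)"
    proof (rule frac_le)
      show "a * ln (ln (real L ^ Suc m)) * b \<le> a * ln (ln (real L ^ t)) * b"
        using lnln[OF _ t(1)] a by (intro mult_right_mono mult_left_mono) auto
      then show "0 \<le> a * ln (ln (real L ^ t)) * b"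
        using nonneg a by (elim order_trans[rotated]) simp
      show "0 < real b ^ (2 * t)" using L_ge_2 by simp
      show "real b ^ (2 * t) \<le> real b ^ (2 * l)" using b1 t by (intro power_increasing) auto
    qed
    ultimately show ?thesis by simp
  next
    case False
    then have "L ^ t < L ^ Suc n0"
      using L_ge_2 by (intro power_strict_increasing) auto
    then have "\<not> real (L ^ Suc n0) \<le> real L ^ t"
      by (metis not_le of_nat_less_iff of_nat_power)
    then have "kernelJ L d a N0 (L ^ Suc n0) {x, y} = real N0"
      unfolding kernelJ_def hlen by simp
    moreover have "a * ln (ln (real L ^ Suc m)) * b / real b ^ (2 * l) \<le> a * ln (ln (real L ^ Suc m)) * b / 1"
      using nonneg a b1 by (intro frac_le) auto
    moreover have "a * ln (ln (real L ^ Suc m)) * b \<le> a * ln (ln (real L ^ Suc n0)) * b"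
      using lnln[of "Suc m" "Suc n0"] t False a by (intro mult_right_mono mult_left_mono) auto
    ultimately show ?thesis using N0 by (simp add: mult_ac)
  qed
qed

text \<open>The set \<open>e\<close> is arbitrary because the locale \<open>percolation\<close> asks
  for a nonnegative kernel also off the edge set. From the cutoff on, the inner logarithm is at
  least 1, so the outer one is nonnegative.\<close>

lemma kernelJ_nonneg:
  fixes a :: real
  assumes "0 < a" "1 \<le> ln (real L ^ Suc n0)"
  shows "0 \<le> kernelJ L d a N0 (L ^ Suc n0) e"
proof (cases "real (L ^ Suc n0) \<le> hlen L e")
  case True
  have pos: "0 < real L ^ Suc n0" using L_ge_2 by simp
  have "real L ^ Suc n0 \<le> hlen L e" using True by simp
  then have "ln (real L ^ Suc n0) \<le> ln (hlen L e)" using pos by (intro ln_mono) auto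
  then have "0 \<le> ln (ln (hlen L e))" using assms(2) by simp
  moreover have "0 < hlen L e" using pos \<open>real L ^ Suc n0 \<le> hlen L e\<close> by linarith
  ultimately show ?thesis using assms(1) by (simp add: kernelJ_def)
qed (simp add: kernelJ_def)

lemma kernelJ_small:
  fixes a :: real
  assumes "x \<in> V" "y \<in> blk n0 x" "x \<noteq> y"
  shows "kernelJ L d a N0 (L ^ Suc n0) {x, y} = real N0"
proof -
  have "lev x y \<le> n0" using lev_le assms by blast
  then have "L ^ lev x y < L ^ Suc n0"
    using L_ge_2 by (intro power_strict_increasing) auto
  then have "\<not> real (L ^ Suc n0) \<le> real L ^ lev x y"
    by (metis not_le of_nat_less_iff of_nat_power)
  moreover have "y \<in> V" using assms(2) blk_subset by blast
  ultimately show ?thesis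
    unfolding kernelJ_def using hlen_eq[OF assms(1) _ assms(3)] by simp
qed

lemma full_mono:
  assumes "full n \<omega> z" "l \<le> n"
  shows "full l \<omega> z"
  using assms coords_mono[OF blk_mono[OF assms(2)], of z] by (auto simp: full_def)

end

lemma ex_power_le:
  fixes B e :: real
  assumes "2 \<le> B" "0 < e"
  shows "\<exists>k. 1 / B ^ k \<le> e"
  using real_arch_pow_inv[of e "1 / B"] assms by (auto simp: power_one_over intro: less_imp_le)

section \<open>Choice of the parameters and conclusion\<close>

theorem theorem1p5:
  fixes L d :: nat and a :: real
  assumes "L \<ge> 2" and "d \<ge> 1" and "a > 1"
  shows "\<exists>q N0 N1. 0 < q \<and> q < 1 \<and>
    measure (perc_measure L d q (kernelJ L d a N0 N1))
      {\<omega> \<in> space (perc_measure L d q (kernelJ L d a N0 N1)).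
         infinite (cluster0 L d \<omega>)} > 0"
proof -
  interpret hierarchical L d using assms by unfold_locales
  define B where "B = real b"
  have B: "2 \<le> B" unfolding B_def by (metis b_ge_2 of_nat_le_iff of_nat_numeral)
  \<comment> \<open>\<open>\<tau>\<close> is the relative error allowed in the cut estimate and
    \<open>\<eta>\<close> the surplus in the exponent:
    \<open>(1 - 3 \<tau>) a = (a + 1) / 2 = 1 + 2 \<eta>\<close>, which exceeds 1.\<close>
  define \<tau> where "\<tau> = (a - 1) / (6 * a)"
  define \<eta> where "\<eta> = (a - 1) / 4"
  define \<gamma> where "\<gamma> = ln (real L)"
  have \<tau>: "0 < \<tau>" "\<tau> < 1" "(1 - 3 * \<tau>) * a = 1 + 2 * \<eta>"
    using assms(3) by (auto simp: \<tau>_def \<eta>_def field_simps)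
  have \<eta>: "0 < \<eta>" using assms(3) by (simp add: \<eta>_def)
  have \<gamma>: "0 < \<gamma>" using assms(1) by (simp add: \<gamma>_def)
  obtain k where k: "1 / B ^ k \<le> \<tau>" using ex_power_le[OF B \<tau>(1)] by blast
  \<comment> \<open>Chosen so that the deficit \<open>\<delta> * b^(n+1)\<close> is exactly half of
    \<open>\<tau> * b^(n-k)\<close>; the other half is reserved for a block of level
    \<open>n - H\<close>.\<close>
  define \<delta> where "\<delta> = \<tau> / (2 * B ^ Suc k)"
  have \<delta>: "0 < \<delta>" using \<tau> B by (simp add: \<delta>_def)
  have \<delta>1: "\<delta> < 1"
  proof -
    have "1 \<le> B ^ Suc k" using B by (intro one_le_power) simp
    then show ?thesis using \<tau>(2) by (simp add: \<delta>_def divide_simps)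
  qed
  \<comment> \<open>The first bound makes \<open>b^(n-H)\<close> at most half of
    \<open>\<tau> * b^(n-k)\<close>; the second prevents a single subblock from filling more than
    half of the allowed deficit.\<close>
  obtain e where e: "1 / B ^ e \<le> min (\<tau> / 2) (\<delta> / 2)"
    using ex_power_le[OF B, of "min (\<tau> / 2) (\<delta> / 2)"] \<tau>(1) \<delta> by auto
  define H where "H = k + e"
  define h where "h n = nat \<lfloor>sqrt (real n)\<rfloor>" for n
  define g where "g n = a * ln (ln (real L ^ Suc (n - H)))" for n
  \<comment> \<open>Summable, yet decaying more slowly than \<open>n^(-(1+2\<eta>))\<close>, which
    leaves room for all constants. Since 0 \<open>powr\<close> anything is 0,
    \<open>lam 0 = 0\<close>, and the loss bounds start at level 1.\<close>
  define lam where "lam n = real n powr - (1 + \<eta>)" for n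
  have lam_nonneg: "0 \<le> lam n" for n by (simp add: lam_def)
  have H: "1 / B ^ Suc H \<le> \<delta> / 2"
  proof -
    have "1 / B ^ Suc H \<le> 1 / B ^ e"
      using B by (intro divide_left_mono power_increasing) (auto simp: H_def)
    then show ?thesis using e by simp
  qed
  have "summable lam"
    unfolding lam_def using \<eta> by (subst summable_real_powr_iff) simp
  then obtain n1 where n1: "\<And>m n. n1 \<le> m \<Longrightarrow> norm (sum lam {m..<n}) < \<delta> / 16"
    using \<delta> unfolding summable_Cauchy by (metis divide_pos_pos zero_less_numeral)
  have "\<forall>\<^sub>F n in at_top.
      2 ^ (b ^ (Suc H + k)) * ((real n - real H + 1) * \<gamma>) powr - (1 + 2 * \<eta>) +
      B ^ (2 * Suc H) * (64 / \<delta>\<^sup>2 * 2 powr (1 - sqrt (real n)) +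
        4 / \<delta> * (sqrt (real n) * (real n / 2) powr - (1 + \<eta>)))\<^sup>2 \<le> lam n"
    unfolding lam_def using \<eta> \<gamma> by (rule eventually_recursion)
  \<comment> \<open>Keeps the whole window of levels above \<open>n / 2\<close>, where
    \<open>lam\<close> is at most \<open>(n/2)^(-(1+\<eta>))\<close>.\<close>
  moreover have "\<forall>\<^sub>F n in at_top. sqrt (real n) + real H + real k + 2 < real n / 2"
    by real_asymp
  moreover have "\<forall>\<^sub>F n in at_top. 1 \<le> (real n - real H + 1) * \<gamma>"
    using \<gamma> by real_asymp
  moreover have "\<forall>\<^sub>F n in at_top. 1 \<le> real n * \<gamma>"
    using \<gamma> by real_asymp
  ultimately have "\<forall>\<^sub>F n in at_top.
      (2 ^ (b ^ (Suc H + k)) * ((real n - real H + 1) * \<gamma>) powr - (1 + 2 * \<eta>) +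
      B ^ (2 * Suc H) * (64 / \<delta>\<^sup>2 * 2 powr (1 - sqrt (real n)) +
        4 / \<delta> * (sqrt (real n) * (real n / 2) powr - (1 + \<eta>)))\<^sup>2 \<le> lam n) \<and>
      sqrt (real n) + real H + real k + 2 < real n / 2 \<and>
      1 \<le> (real n - real H + 1) * \<gamma> \<and> 1 \<le> real n * \<gamma> \<and> n1 \<le> n"
    using eventually_ge_at_top[of n1] by eventually_elim simp
  then obtain n0 where n0: "\<And>n. n0 \<le> n \<Longrightarrow>
      2 ^ (b ^ (Suc H + k)) * ((real n - real H + 1) * \<gamma>) powr - (1 + 2 * \<eta>) +
      B ^ (2 * Suc H) * (64 / \<delta>\<^sup>2 * 2 powr (1 - sqrt (real n)) +
        4 / \<delta> * (sqrt (real n) * (real n / 2) powr - (1 + \<eta>)))\<^sup>2 \<le> lam n"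
    "\<And>n. n0 \<le> n \<Longrightarrow> sqrt (real n) + real H + real k + 2 < real n / 2"
    "\<And>n. n0 \<le> n \<Longrightarrow> 1 \<le> (real n - real H + 1) * \<gamma>"
    "1 \<le> real n0 * \<gamma>" "n1 \<le> n0"
    unfolding eventually_at_top_linorder by blast
  have hn: "real (h n) \<le> sqrt (real n)" "sqrt (real n) < real (h n) + 1" for n
    unfolding h_def by (simp, linarith)
  have large: "1 \<le> n \<and> k < n - H \<and> h n < n - H" and half: "real n / 2 \<le> real (n - H - h n)"
    and Hn: "H \<le> n" if "n0 \<le> n" for n
  proof -
    have "real H + real k + 2 + real (h n) < real n / 2"
      using n0(2)[OF that] hn(1)[of n] by linarith
    then have "real (2 * (H + k + 2 + h n)) < real n" by simp
    then have *: "2 * (H + k + 2 + h n) < n" unfolding of_nat_less_iff .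
    show "1 \<le> n \<and> k < n - H \<and> h n < n - H" using * by auto
    show "H \<le> n" using * by simp
    have "n \<le> 2 * (n - H - h n)" using * by simp
    then have "real n \<le> real (2 * (n - H - h n))" unfolding of_nat_le_iff .
    then show "real n / 2 \<le> real (n - H - h n)" by simp
  qed
  have n0_pos: "1 \<le> n0" using large[OF order_refl] by simp
  have ln_pow: "ln (real L ^ j) = real j * \<gamma>" for j
    using assms(1) by (simp add: ln_realpow \<gamma>_def)
  have ln_level: "ln (real L ^ Suc (n - H)) = (real n - real H + 1) * \<gamma>" if "n0 \<le> n" for n
    unfolding ln_pow using Hn[OF that] by (simp add: of_nat_diff)
  have g_nonneg: "0 \<le> ln (ln (real L ^ Suc (n - H)))" if "n0 \<le> n" for n
    unfolding ln_level[OF that] using n0(3)[OF that] by simp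

  \<comment> \<open>\<open>\<kappa>\<close> serves both base cases: \<open>\<delta>/16\<close> for
    failures of \<open>big\<close>, and \<open>lam n0\<close>, the least value of \<open>lam\<close>
    on levels 1 to \<open>n0\<close>, for losses. Next, \<open>c\<close> distributes
    \<open>\<kappa>\<close> over the coordinates of an \<open>n0\<close>-block.\<close>
  define \<kappa> where "\<kappa> = min (\<delta> / 16) (lam n0)"
  define c where "c = \<kappa> / (real b ^ n0 + real b ^ n0 * real b ^ n0)"
  \<comment> \<open>The minimum with 1/2 keeps \<open>q\<close> positive even if \<open>c\<close> is
    large.\<close>
  define q where "q = 1 - min c (1 / 2)"
  \<comment> \<open>The first bound makes a short edge closed with probability at most
    \<open>c\<close>; the second lets the constant part dominate the double logarithmic one in
    \<open>kernelJ_ge\<close>.\<close>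
  define N0 where "N0 = nat \<lceil>max (- ln c) (a * b * ln (ln (real L ^ Suc n0)))\<rceil>"
  let ?J = "kernelJ L d a N0 (L ^ Suc n0)"
  have \<kappa>: "0 < \<kappa>" using \<delta> n0_pos by (simp add: \<kappa>_def lam_def)
  have bsum: "0 < real b ^ n0 + real b ^ n0 * real b ^ n0"
    using B unfolding B_def[symmetric] by (intro add_pos_pos mult_pos_pos zero_less_power) auto
  have c: "0 < c" using \<kappa> bsum unfolding c_def by (rule divide_pos_pos)
  have q: "0 < q" "q < 1" "1 - q \<le> c" using c by (auto simp: q_def)
  have "max (- ln c) (a * b * ln (ln (real L ^ Suc n0))) \<le> real N0"
    unfolding N0_def by (rule real_nat_ceiling_ge)
  then have N0: "- ln c \<le> real N0" "a * b * ln (ln (real L ^ Suc n0)) \<le> real N0" by simp_all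
  have "1 \<le> ln (real L ^ Suc n0)"
    unfolding ln_pow using n0(4) \<gamma> by (simp add: algebra_simps)
  then have "0 \<le> ?J e" for e using assms(3) by (intro kernelJ_nonneg) auto
  then interpret percolation L d q ?J
    using q by unfold_locales simp_all
  have not_full: "Pr (\<lambda>\<omega>. \<not> full n0 \<omega> z) \<le> \<kappa>" if "z \<in> V" for z
  proof -
    have "exp (- ?J {x, y}) \<le> c" if "x \<in> V" "y \<in> blk n0 x" "x \<noteq> y" for x y
    proof -
      have "exp (- real N0) \<le> exp (ln c)" using N0(1) by simp
      then show ?thesis unfolding kernelJ_small[OF that] using c by simp
    qed
    then have "Pr (\<lambda>\<omega>. \<not> full n0 \<omega> z) \<le> real (b ^ n0 + b ^ n0 * b ^ n0) * c"
      using Pr_not_full_le[OF that less_imp_le[OF c] q(3)] by blast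
    also have "\<dots> = \<kappa>"
      using bsum unfolding c_def of_nat_add of_nat_mult of_nat_power by simp
    finally show ?thesis .
  qed
  have "Pr (\<lambda>\<omega>. \<not> big k n \<omega> horigin) \<le> \<delta> / 8" for n
  proof (rule Pr_loss_and_Pr_not_big(2)[where lam=lam and g=g and h=h and H=H and \<epsilon>=\<tau> and ?n0.0=n0])
    show "1 / real b ^ Suc H \<le> \<delta> / 2" using H unfolding B_def .
    show "1 / real b ^ k \<le> \<tau>" using k unfolding B_def .
    show "k \<le> H" by (simp add: H_def)
    show "Pr (\<lambda>\<omega>. loss k l \<omega> z) \<le> lam l" if "z \<in> V" "1 \<le> l" "l < n0" for l z
    proof -
      \<comment> \<open>A full \<open>n0\<close>-block has only full subblocks, and the only cluster
        of a full block is the block itself, too large for the window of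
        \<open>loss\<close>.\<close>
      have "Pr (\<lambda>\<omega>. loss k l \<omega> z) \<le> Pr (\<lambda>\<omega>. \<not> full n0 \<omega> z)"
        using not_loss_if_full[OF that(1)] full_mono[of n0 _ z "Suc l"] that
        by (intro Pr_mono event_not event_full) auto
      also have "\<dots> \<le> lam n0" using not_full[OF that(1)] by (simp add: \<kappa>_def)
      also have "\<dots> \<le> lam l" unfolding lam_def using that \<eta> by (intro powr_mono2') auto
      finally show ?thesis .
    qed
    show "Pr (\<lambda>\<omega>. \<not> big k l \<omega> x) \<le> \<delta> / 16" if "x \<in> V" "l \<le> n0" for l x
    proof -
      have "Pr (\<lambda>\<omega>. \<not> big k l \<omega> x) \<le> Pr (\<lambda>\<omega>. \<not> full n0 \<omega> x)"
        using big_if_full[OF that(1)] full_mono[of n0 _ x l] that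
        by (intro Pr_mono event_not event_full) auto
      also have "\<dots> \<le> \<delta> / 16" using not_full[OF that(1)] by (simp add: \<kappa>_def)
      finally show ?thesis .
    qed
    show "sum lam {n0..<N} \<le> \<delta> / 16" for N
      using n1[OF n0(5), of N] by simp
    show "\<delta> * real b ^ Suc n + real b ^ (n - H) \<le> \<tau> * real b ^ (n - k)" if "n0 \<le> n" for n
    proof -
      have "n - k = (n - H) + e" "Suc n = Suc k + (n - k)" using Hn[OF that] by (auto simp: H_def)
      then have pow: "B ^ (n - k) = B ^ (n - H) * B ^ e" "B ^ Suc n = B ^ Suc k * B ^ (n - k)"
        by (simp_all only: power_add)
      have "\<delta> * B ^ Suc n = \<tau> / 2 * B ^ (n - k)"
        unfolding pow(2) \<delta>_def using B by simp
      moreover have "B ^ (n - H) \<le> \<tau> / 2 * B ^ (n - k)"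
      proof -
        have "1 \<le> \<tau> / 2 * B ^ e" using e B by (simp add: divide_simps split: if_splits)
        then have "B ^ (n - H) * 1 \<le> B ^ (n - H) * (\<tau> / 2 * B ^ e)"
          using B by (intro mult_left_mono) auto
        then show ?thesis unfolding pow(1) by (simp add: mult_ac)
      qed
      ultimately show ?thesis unfolding B_def[symmetric] by linarith
    qed
    show "1 \<le> n \<and> k < n - H \<and> h n < n - H" if "n0 \<le> n" for n by (rule large[OF that])
    show "0 \<le> g n" if "n0 \<le> n" for n
      unfolding g_def using g_nonneg[OF that] assms(3) by simp
    show "g n * real b / real b ^ (2 * l) \<le> ?J {x, y}"
      if "n0 \<le> n" "x \<in> V" "y \<in> blk l x" "y \<notin> blk (n - H) x" for n x y l
      unfolding g_def using assms(3)
      by (intro kernelJ_ge[OF that(2,3,4) _ g_nonneg[OF that(1)] N0(2)]) simp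
    show "2 ^ b ^ (Suc H + k) * exp (- ((1 - 3 * \<tau>) * g n)) +
        real b ^ (2 * Suc H) *
        (64 / (\<delta>\<^sup>2 * real b ^ h n) + 4 / \<delta> * sum lam {n - H - h n..<n - H})\<^sup>2 \<le> lam n"
      if n: "n0 \<le> n" for n
    proof -
      let ?X = "(real n - real H + 1) * \<gamma>"
      \<comment> \<open>The cut weight is \<open>a * ln ?X\<close> up to the factor
        \<open>1 - 3 \<tau>\<close>, so the isolation probability becomes the summable power
        \<open>?X powr - (1 + 2 * \<eta>)\<close>.\<close>
      have "(1 - 3 * \<tau>) * g n = (1 + 2 * \<eta>) * ln ?X"
        unfolding g_def ln_level[OF n] \<tau>(3)[symmetric] by simp
      then have ex: "exp (- ((1 - 3 * \<tau>) * g n)) = ?X powr - (1 + 2 * \<eta>)"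
        using n0(3)[OF n] unfolding powr_def mult_minus_left by auto
      have t1: "64 / (\<delta>\<^sup>2 * B ^ h n) \<le> 64 / \<delta>\<^sup>2 * 2 powr (1 - sqrt (real n))"
      proof -
        have "2 powr (sqrt (real n) - 1) \<le> 2 powr real (h n)"
          using hn(2)[of n] by (intro powr_mono) auto
        also have "\<dots> = 2 ^ h n" by (simp add: powr_realpow)
        also have "\<dots> \<le> B ^ h n" using B by (intro power_mono) auto
        finally have "1 / B ^ h n \<le> 1 / 2 powr (sqrt (real n) - 1)"
          by (intro divide_left_mono) (use B in auto)
        also have "\<dots> = 2 powr (1 - sqrt (real n))"
          using powr_minus_divide[of 2 "sqrt (real n) - 1"] by simp
        finally have "64 / \<delta>\<^sup>2 * (1 / B ^ h n) \<le> 64 / \<delta>\<^sup>2 * 2 powr (1 - sqrt (real n))"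
          by (intro mult_left_mono) auto
        then show ?thesis by simp
      qed
      have "sum lam {n - H - h n..<n - H} \<le> (\<Sum>l\<in>{n - H - h n..<n - H}. (real n / 2) powr - (1 + \<eta>))"
        unfolding lam_def
      proof (rule sum_mono)
        fix l assume "l \<in> {n - H - h n..<n - H}"
        then have "real n / 2 \<le> real l" using half[OF n] by simp
        then show "real l powr - (1 + \<eta>) \<le> (real n / 2) powr - (1 + \<eta>)"
          using large[OF n] \<eta> by (intro powr_mono2') auto
      qed
      also have "\<dots> = real (h n) * (real n / 2) powr - (1 + \<eta>)"
      proof -
        have "card {n - H - h n..<n - H} = h n" using large[OF n] by simp linarith
        then show ?thesis by simp
      qed
      also have "\<dots> \<le> sqrt (real n) * (real n / 2) powr - (1 + \<eta>)"
        using hn(1) by (intro mult_right_mono) auto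
      finally have t2: "4 / \<delta> * sum lam {n - H - h n..<n - H} \<le>
          4 / \<delta> * (sqrt (real n) * (real n / 2) powr - (1 + \<eta>))"
        using \<delta> by (intro mult_left_mono) auto
      have "0 \<le> 64 / (\<delta>\<^sup>2 * B ^ h n) + 4 / \<delta> * sum lam {n - H - h n..<n - H}"
        using \<delta> B lam_nonneg by (intro add_nonneg_nonneg mult_nonneg_nonneg sum_nonneg) auto
      then have "(64 / (\<delta>\<^sup>2 * B ^ h n) + 4 / \<delta> * sum lam {n - H - h n..<n - H})\<^sup>2 \<le>
          (64 / \<delta>\<^sup>2 * 2 powr (1 - sqrt (real n)) +
            4 / \<delta> * (sqrt (real n) * (real n / 2) powr - (1 + \<eta>)))\<^sup>2"
        using t1 t2 by (intro power_mono add_mono)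
      then have "B ^ (2 * Suc H) * (64 / (\<delta>\<^sup>2 * B ^ h n) + 4 / \<delta> * sum lam {n - H - h n..<n - H})\<^sup>2 \<le>
          B ^ (2 * Suc H) * (64 / \<delta>\<^sup>2 * 2 powr (1 - sqrt (real n)) +
            4 / \<delta> * (sqrt (real n) * (real n / 2) powr - (1 + \<eta>)))\<^sup>2"
        using B by (intro mult_left_mono) auto
      then show ?thesis
        using n0(1)[OF n] unfolding ex B_def[symmetric] by linarith
    qed
  qed (fact \<delta>, fact horigin_in_V)
  then have "1 - \<delta> / 8 \<le> Pr (\<lambda>\<omega>. infinite (cluster0 L d \<omega>))"
    by (rule Pr_infinite_cluster0)
  then have "0 < Pr (\<lambda>\<omega>. infinite (cluster0 L d \<omega>))" using \<delta>1 by linarith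
  then have "0 < measure (perc_measure L d q ?J)
      {\<omega> \<in> space (perc_measure L d q ?J). infinite (cluster0 L d \<omega>)}"
    unfolding perc_measure_eq Pr_def .
  then show ?thesis using q by blast
qed

end
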